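(* Let $\mathfrak{s}$ be a nonzero finite-dimensional complex solvable Lie algebra with nilradical $\mathfrak{n}$ and a vector-space complement $\mathfrak{v}$, $\mathfrak{s}=\mathfrak{n}\oplus\mathfrak{v}$. Let $\Delta\subset\mathfrak{v}^*$ be the set of distinct nilradical weights, with multiplicities $m_\alpha$ ($\alpha\in\Delta$), and let $\kappa(\mathfrak{s})$ be the spectral index. Then \[ \dim\mathfrak{v}+1\leq\kappa(\mathfrak{s})\leq\dim\mathfrak{n}+1. \] Moreover, $\kappa(\mathfrak{s})=\dim\mathfrak{v}+1$ if and only if the nonzero weights $\Delta\setminus\{0\}$ form a basis of $\mathfrak{v}^*$. Also, $\kappa(\mathfrak{s})=\dim\mathfrak{n}+1$ if and only if $0\notin\Delta$ and $m_\alpha=1$ for all $\alpha\in\Delta$.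
   Context: The nilradical is the unique maximal nilpotent ideal. Put $M=\dim\mathfrak{n}$. Nilradical weights: By Lie's theorem there is a basis of $\mathfrak{n}$ in which all operators $\operatorname{ad}(y)|_{\mathfrak{n}}$, $y\in\mathfrak{s}$, are upper triangular; the diagonal entries are linear functionals $\lambda_1,\dots,\lambda_M\in\mathfrak{s}^*$, which vanish on $\mathfrak{n}$. The nilradical weight multiset is $\{\lambda_1|_{\mathfrak{v}},\dots,\lambda_M|_{\mathfrak{v}}\}$ counted with multiplicity (independent of the triangularizing basis); $\Delta$ is its set of distinct elements and $m_\alpha$ is the multiplicity of $\alpha$. Characteristic polynomial: for a basis $y_1,\dots,y_N$ of $\mathfrak{s}$, $Q_{\mathfrak{s}}(z_0,\mathbf{z})=\det(z_0I+\sum_{i=1}^N z_i\operatorname{ad}y_i)$. The spectral index $\kappa(\mathfrak{s})$ is the number of distinct irreducible factors of $Q_{\mathfrak{s}}$ (it does not depend on the basis). *)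

theory Defs
  imports
    Complex_Main
    "HOL-Library.Function_Algebras"
    "HOL-Library.Poly_Mapping"
    "HOL-Library.Multiset"
    "Jordan_Normal_Form.Determinant"
begin

section \<open>Polynomials in the variables $z_0, z_1, z_2, \dots$\<close>

text \<open>
  A polynomial is a finitely supported map from exponent vectors to coefficients. The ring has
  countably many variables; this does not affect irreducible factors, since every divisor of a
  nonzero polynomial in \<open>z\<^sub>0, \<dots>, z\<^sub>N\<close> involves only these variables and the units are
  the nonzero constants in either ring.
\<close>

type_synonym cpoly = "(nat \<Rightarrow>\<^sub>0 nat) \<Rightarrow>\<^sub>0 complex"

definition pvar :: "nat \<Rightarrow> cpoly"
  where "pvar i = Poly_Mapping.single (Poly_Mapping.single i 1) 1"

definition pconst :: "complex \<Rightarrow> cpoly"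
  where "pconst c = Poly_Mapping.single 0 c"

text \<open>Distinct irreducible factors are counted up to associates, that is, up to unit multiples.\<close>

definition associates :: "'a::comm_semiring_1 \<Rightarrow> 'a set"
  where "associates p = {q. p dvd q \<and> q dvd p}"

definition num_irreducible_factors :: "'a::comm_semiring_1 \<Rightarrow> nat"
  where "num_irreducible_factors Q =
    card (associates ` {p. Factorial_Ring.irreducible p \<and> p dvd Q})"


section \<open>Functionals\<close>

definition fscale :: "complex \<Rightarrow> ('a \<Rightarrow> complex) \<Rightarrow> ('a \<Rightarrow> complex)"
  where "fscale c f = (\<lambda>x. c * f x)"

global_interpretation functionals: vector_space fscale
  by unfold_locales (auto simp: fscale_def fun_eq_iff algebra_simps)

text \<open>
  The dual of a subspace \<open>V\<close> is modelled inside the space of all functions: a functional on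
  \<open>V\<close> is represented by its extension by zero outside \<open>V\<close>.
\<close>

definition restrict0 :: "'a set \<Rightarrow> ('a \<Rightarrow> complex) \<Rightarrow> ('a \<Rightarrow> complex)"
  where "restrict0 V f = (\<lambda>x. if x \<in> V then f x else 0)"

definition dual_space :: "(complex \<Rightarrow> 'a \<Rightarrow> 'a) \<Rightarrow> 'a::ab_group_add set \<Rightarrow> ('a \<Rightarrow> complex) set"
  where "dual_space scale V = {f. (\<forall>x. x \<notin> V \<longrightarrow> f x = 0) \<and>
    (\<forall>x\<in>V. \<forall>y\<in>V. f (x + y) = f x + f y) \<and>
    (\<forall>c. \<forall>x\<in>V. f (scale c x) = c * f x)}"


section \<open>Complex Lie algebras\<close>

locale complex_lie_algebra = vector_space scale
  for scale :: "complex \<Rightarrow> 'a::ab_group_add \<Rightarrow> 'a" +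
  fixes bracket :: "'a \<Rightarrow> 'a \<Rightarrow> 'a"
  assumes bracket_add_left: "bracket (x + y) z = bracket x z + bracket y z"
    and bracket_add_right: "bracket x (y + z) = bracket x y + bracket x z"
    and bracket_scale_left: "bracket (scale c x) y = scale c (bracket x y)"
    and bracket_scale_right: "bracket x (scale c y) = scale c (bracket x y)"
    and bracket_self: "bracket x x = 0"
    and jacobi: "bracket x (bracket y z) + bracket y (bracket z x) + bracket z (bracket x y) = 0"
begin

definition bracket_space :: "'a set \<Rightarrow> 'a set \<Rightarrow> 'a set"
  where "bracket_space A B = span {bracket x y | x y. x \<in> A \<and> y \<in> B}"

definition derived_series :: "'a set \<Rightarrow> nat \<Rightarrow> 'a set"
  where "derived_series A k = ((\<lambda>B. bracket_space B B) ^^ k) A"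

definition lower_central_series :: "'a set \<Rightarrow> nat \<Rightarrow> 'a set"
  where "lower_central_series A k = (bracket_space A ^^ k) A"

definition lie_solvable :: bool
  where "lie_solvable \<longleftrightarrow> (\<exists>k. derived_series UNIV k = {0})"

definition lie_nilpotent :: "'a set \<Rightarrow> bool"
  where "lie_nilpotent A \<longleftrightarrow> (\<exists>k. lower_central_series A k = {0})"

definition lie_ideal :: "'a set \<Rightarrow> bool"
  where "lie_ideal I \<longleftrightarrow> subspace I \<and> (\<forall>x. \<forall>y\<in>I. bracket x y \<in> I)"

text \<open>In finite dimension there is exactly one maximal nilpotent ideal.\<close>

definition is_nilradical :: "'a set \<Rightarrow> bool"
  where "is_nilradical \<nn> \<longleftrightarrow> lie_ideal \<nn> \<and> lie_nilpotent \<nn> \<and>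
    (\<forall>I. lie_ideal I \<and> lie_nilpotent I \<and> \<nn> \<subseteq> I \<longrightarrow> I = \<nn>)"

definition is_complement :: "'a set \<Rightarrow> 'a set \<Rightarrow> bool"
  where "is_complement W V \<longleftrightarrow> subspace V \<and> W \<inter> V = {0} \<and> {w + v | w v. w \<in> W \<and> v \<in> V} = UNIV"

definition ordered_basis :: "'a set \<Rightarrow> 'a list \<Rightarrow> bool"
  where "ordered_basis V es \<longleftrightarrow> distinct es \<and> independent (set es) \<and> span (set es) = V"

text \<open>
  The entry in row \<open>i\<close> and column \<open>j\<close> of the matrix of $\mathrm{ad}(y)$ with respect to \<open>es\<close>, the
  basis of an ideal (possibly the whole algebra).
\<close>

definition ad_entry :: "'a list \<Rightarrow> 'a \<Rightarrow> nat \<Rightarrow> nat \<Rightarrow> complex"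
  where "ad_entry es y i j = representation (set es) (bracket y (es ! j)) (es ! i)"

definition triangularizing_basis :: "'a set \<Rightarrow> 'a list \<Rightarrow> bool"
  where "triangularizing_basis I es \<longleftrightarrow> ordered_basis I es \<and>
    (\<forall>y i j. j < i \<longrightarrow> i < length es \<longrightarrow> ad_entry es y i j = 0)"

text \<open>
  The weights are the diagonal entries \<open>\<lambda>y. ad_entry es y i i\<close>, restricted to the complement. For
  a solvable finite-dimensional algebra a triangularizing basis exists by Lie's theorem, and the
  multiset does not depend on which one is chosen.
\<close>

definition weight_mset :: "'a set \<Rightarrow> 'a set \<Rightarrow> ('a \<Rightarrow> complex) multiset"
  where "weight_mset \<nn> \<vv> =
    (let es = (SOME es. triangularizing_basis \<nn> es)
     in mset (map (\<lambda>i. restrict0 \<vv> (\<lambda>y. ad_entry es y i i)) [0..<length es]))"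

text \<open>
  $\det(z_0 I + \sum_{i=1}^N z_i\,\mathrm{ad}\,y_i)$; since lists are indexed from zero, $y_i$ is
  \<open>ys ! (i - 1)\<close>.
\<close>

definition lie_char_poly :: "'a list \<Rightarrow> cpoly"
  where "lie_char_poly ys =
    det (mat (length ys) (length ys)
      (\<lambda>(k, j). (if k = j then pvar 0 else 0) +
        (\<Sum>i<length ys. pvar (Suc i) * pconst (ad_entry ys (ys ! i) k j))))"

definition spectral_index :: "'a list \<Rightarrow> nat"
  where "spectral_index ys = num_irreducible_factors (lie_char_poly ys)"

end

end

theory Submission
  imports Defs "HOL-Computational_Algebra.Fundamental_Theorem_Algebra"
begin

text \<open>
  By Lie's theorem the nilradical has a triangularizing basis. All brackets lie in the nilradical, so
  appending a basis of the complement gives a triangularizing basis of the whole algebra, whose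
  diagonal functionals are the nilradical weights and zeros. In this basis the characteristic
  polynomial is a product of linear forms $z_0 + \sum_i \lambda(y_i) z_i$, which are prime and
  associated only if they are equal. Hence \<open>\<kappa>\<close> counts the distinct diagonal functionals. Zero is always
  one of them: either the complement is nonzero, or the algebra equals its nilradical and all weights
  on the complement vanish. All of them vanish on the nilradical, so they can be compared after
  restriction to the complement, and \<open>\<kappa> = card (\<Delta> - {0}) + 1\<close> (lemma \<open>spectral_index_eq\<close>).

  The nilradical consists exactly of the elements at which every diagonal functional vanishes
  (\<open>nilradical_eq_diag_zero\<close>): these elements form an ideal that is nilpotent and contains every other
  nilpotent ideal. Therefore no nonzero element of the complement is killed by all weights, and the
  nonzero weights span the dual of the complement (\<open>span_weights\<close>). This gives the lower bound, with
  equality exactly when the spanning set is a basis. The upper bound holds because there are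
  \<open>dim \<nn>\<close> weights with multiplicity; discarding zero and repetitions loses none of them exactly when
  zero is not a weight and all multiplicities are one (\<open>card_set_mset_minus\<close>).

  Lie's theorem is proved in the form that an ideal not contained in an ideal \<open>J\<close> contains a common
  eigenvector modulo \<open>J\<close> outside \<open>J\<close> (\<open>common_eigenvector_mod\<close>).
\<close>

section \<open>Krylov sequences and eigenvectors modulo a subspace\<close>

locale finite_dim_complex_space = finite_dimensional_vector_space scale Basis
  for scale :: "complex \<Rightarrow> 'b::ab_group_add \<Rightarrow> 'b" and Basis
begin

notation scale (infixr "\<cdot>" 75)

text \<open>
  The span of \<open>J\<close> and the first \<open>i\<close> iterates of \<open>v\<close> under \<open>T\<close>. Working modulo an invariant
  subspace \<open>J\<close> in this way replaces passing to a quotient space.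
\<close>

definition krylov :: "'b set \<Rightarrow> ('b \<Rightarrow> 'b) \<Rightarrow> 'b \<Rightarrow> nat \<Rightarrow> 'b set"
  where "krylov J T v i = span (J \<union> (\<lambda>j. (T ^^ j) v) ` {..<i})"

lemma krylov_mono: "i \<le> j \<Longrightarrow> krylov J T v i \<subseteq> krylov J T v j"
  unfolding krylov_def by (rule span_mono) auto

lemma subspace_krylov: "subspace (krylov J T v i)"
  by (simp add: krylov_def)

lemma krylov_0: "subspace J \<Longrightarrow> krylov J T v 0 = J"
  by (simp add: krylov_def)

lemma subset_krylov: "J \<subseteq> krylov J T v i"
  unfolding krylov_def using span_superset by blast

lemma funpow_in_krylov: "j < i \<Longrightarrow> (T ^^ j) v \<in> krylov J T v i"
  unfolding krylov_def by (rule span_base) auto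

lemma krylov_Suc_image:
  assumes "module_hom scale scale T" "T ` J \<subseteq> J" "u \<in> krylov J T v i"
  shows "T u \<in> krylov J T v (Suc i)"
proof -
  interpret T: module_hom scale scale T by fact
  have "T u \<in> span (T ` (J \<union> (\<lambda>j. (T ^^ j) v) ` {..<i}))"
    using assms(3) unfolding krylov_def T.span_image by blast
  moreover have "T ` (J \<union> (\<lambda>j. (T ^^ j) v) ` {..<i}) \<subseteq> krylov J T v (Suc i)"
  proof -
    have "T ((T ^^ j) v) \<in> krylov J T v (Suc i)" if "j < i" for j
      using funpow_in_krylov[of "Suc j" "Suc i" T v J] that by simp
    then show ?thesis using assms(2) subset_krylov[of J T v "Suc i"] by blast
  qed
  ultimately show ?thesis
    using span_minimal[OF _ subspace_krylov] by blast
qed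

definition poly_apply :: "complex poly \<Rightarrow> ('b \<Rightarrow> 'b) \<Rightarrow> 'b \<Rightarrow> 'b"
  where "poly_apply p T v = (\<Sum>i\<le>degree p. coeff p i \<cdot> (T ^^ i) v)"

lemma poly_apply_eq_sum:
  assumes "degree p \<le> n"
  shows "poly_apply p T v = (\<Sum>i\<le>n. coeff p i \<cdot> (T ^^ i) v)"
  unfolding poly_apply_def
  by (rule sum.mono_neutral_left) (use assms in \<open>auto simp: coeff_eq_0\<close>)

text \<open>
  This identity is what lets a zero \<open>c\<close> of an annihilating polynomial be split off: either
  $(T - c)v$ lies in \<open>J\<close>, so that \<open>v\<close> is an eigenvector modulo \<open>J\<close>, or the search goes on with the
  vector $(T - c)v$ and a polynomial of smaller degree.
\<close>

lemma poly_apply_linear_factor: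
  assumes "module_hom scale scale T"
  shows "poly_apply ([:- c, 1:] * q) T v = poly_apply q T (T v - c \<cdot> v)"
proof -
  interpret T: module_hom scale scale T by fact
  have pow: "module_hom scale scale (T ^^ i)" for i
    by (induct i) (simp_all add: module_hom_iff module_axioms T.add T.scale)
  have *: "(T ^^ i) (T v - c \<cdot> v) = (T ^^ Suc i) v - c \<cdot> (T ^^ i) v" for i
  proof -
    interpret Ti: module_hom scale scale "T ^^ i" by (rule pow)
    show ?thesis by (simp add: Ti.diff Ti.scale funpow_swap1)
  qed
  define n where "n = degree q"
  have deg: "degree ([:- c, 1:] * q) \<le> Suc n"
    unfolding n_def using degree_mult_le[of "[:- c, 1:]" q] by simp
  have q: "coeff q (Suc n) = 0" by (simp add: n_def coeff_eq_0)
  have "poly_apply ([:- c, 1:] * q) T v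
      = (\<Sum>i\<le>Suc n. (- (c * coeff q i) + coeff (pCons 0 q) i) \<cdot> (T ^^ i) v)"
    unfolding poly_apply_eq_sum[OF deg]
    by (intro sum.cong refl) (simp add: mult_pCons_left)
  also have "\<dots> = (\<Sum>i\<le>Suc n. (- (c * coeff q i)) \<cdot> (T ^^ i) v)
      + (\<Sum>i\<le>Suc n. coeff (pCons 0 q) i \<cdot> (T ^^ i) v)"
    by (simp only: scale_left_distrib sum.distrib)
  also have "(\<Sum>i\<le>Suc n. (- (c * coeff q i)) \<cdot> (T ^^ i) v)
      = (\<Sum>i\<le>n. (- (c * coeff q i)) \<cdot> (T ^^ i) v)"
    by (simp only: sum.atMost_Suc q) simp
  also have "(\<Sum>i\<le>Suc n. coeff (pCons 0 q) i \<cdot> (T ^^ i) v)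
      = (\<Sum>i\<le>n. coeff q i \<cdot> (T ^^ Suc i) v)"
    by (simp only: sum.atMost_Suc_shift coeff_pCons_Suc coeff_pCons_0 scale_zero_left add_0_left)
  also have "(\<Sum>i\<le>n. (- (c * coeff q i)) \<cdot> (T ^^ i) v)
      + (\<Sum>i\<le>n. coeff q i \<cdot> (T ^^ Suc i) v) = poly_apply q T (T v - c \<cdot> v)"
    unfolding poly_apply_def * n_def[symmetric] sum.distrib[symmetric]
    by (intro sum.cong refl) (simp only: scale_right_diff_distrib scale_scale scale_minus_left
        mult.commute[of c] uminus_add_conv_diff)
  finally show ?thesis .
qed

text \<open>
  Otherwise the iterates of \<open>v\<close> would form arbitrarily large independent sets.
\<close>

lemma krylov_stabilizes:
  "\<exists>n. (T ^^ n) v \<in> krylov J T v n"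
proof (rule ccontr)
  assume *: "\<nexists>n. (T ^^ n) v \<in> krylov J T v n"
  have "independent ((\<lambda>j. (T ^^ j) v) ` {..<m}) \<and> card ((\<lambda>j. (T ^^ j) v) ` {..<m}) = m" for m
  proof (induct m)
    case 0
    then show ?case by (simp add: independent_empty)
  next
    case (Suc m)
    let ?A = "(\<lambda>j. (T ^^ j) v) ` {..<m}"
    have "span ?A \<subseteq> krylov J T v m"
      unfolding krylov_def by (rule span_mono) auto
    then have "(T ^^ m) v \<notin> span ?A" using * by blast
    moreover from this have "(T ^^ m) v \<notin> ?A" by (rule contra_subsetD[OF span_superset])
    moreover have "(\<lambda>j. (T ^^ j) v) ` {..<Suc m} = insert ((T ^^ m) v) ?A"
      by (auto simp: less_Suc_eq)
    ultimately show ?case using Suc by (simp add: independent_insertI)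
  qed
  from this[of "Suc (dim UNIV)"] show False
    using independent_card_le_dim[of "(\<lambda>j. (T ^^ j) v) ` {..<Suc (dim UNIV)}" UNIV] by simp
qed

lemma eigenvector_mod_of_annihilating_poly:
  assumes T: "module_hom scale scale T" and E: "subspace E" "T ` E \<subseteq> E"
    and J: "subspace J"
    and "p \<noteq> 0" "v \<in> E" "v \<notin> J" "poly_apply p T v \<in> J"
  shows "\<exists>w\<in>E - J. \<exists>c. T w - scale c w \<in> J"
  using assms(5-)
proof (induct "degree p" arbitrary: p v)
  case 0
  then have "scale (coeff p 0) v \<in> J" by (simp add: poly_apply_def)
  moreover have "coeff p 0 \<noteq> 0" using 0 by (metis leading_coeff_0_iff)
  ultimately have "scale (inverse (coeff p 0)) (scale (coeff p 0) v) \<in> J"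
    using J subspace_scale by blast
  then show ?case using 0 \<open>coeff p 0 \<noteq> 0\<close> by simp
next
  case (Suc n)
  have "\<not> constant (poly p)" using Suc.hyps(2) by (simp add: constant_degree)
  then obtain c where "poly p c = 0" using fundamental_theorem_of_algebra by blast
  then obtain q where pq: "p = [:- c, 1:] * q" by (auto simp: poly_eq_0_iff_dvd dvd_def)
  have q0: "q \<noteq> 0" using pq Suc.prems(1) by auto
  then have "degree p = degree [:- c, 1:] + degree q" unfolding pq by (intro degree_mult_eq) auto
  then have deg: "n = degree q" using Suc.hyps(2) by simp
  show ?case
  proof (cases "T v - scale c v \<in> J")
    case True
    then show ?thesis using Suc.prems by blast
  next
    case False
    have "T v - scale c v \<in> E"
      using E Suc.prems(2) by (intro subspace_diff subspace_scale) auto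
    then show ?thesis
      using Suc.hyps(1)[OF deg q0 _ False] Suc.prems(4)
      unfolding pq poly_apply_linear_factor[OF T] by blast
  qed
qed

lemma eigenvector_mod_exists:
  assumes T: "module_hom scale scale T" and E: "subspace E" "T ` E \<subseteq> E"
    and J: "subspace J" and "v \<in> E" "v \<notin> J"
  shows "\<exists>w\<in>E - J. \<exists>c. T w - scale c w \<in> J"
proof -
  obtain n where "(T ^^ n) v \<in> krylov J T v n" using krylov_stabilizes by blast
  then have "(T ^^ n) v \<in> span (J \<union> (\<lambda>j. (T ^^ j) v) ` {..<n})" by (simp add: krylov_def)
  then obtain a b where ab: "(T ^^ n) v = a + b" "a \<in> J" "b \<in> span ((\<lambda>j. (T ^^ j) v) ` {..<n})"
    unfolding span_Un span_eq_iff[THEN iffD2, OF J] by blast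
  have "\<exists>u. b = (\<Sum>j<n. scale (u j) ((T ^^ j) v))"
    using ab(3)
  proof (induct rule: span_induct_alt)
    case base
    show ?case by (rule exI[of _ "\<lambda>_. 0"]) simp
  next
    case (step c x y)
    then obtain u j where u: "y = (\<Sum>j<n. scale (u j) ((T ^^ j) v))"
      and j: "j < n" "x = (T ^^ j) v" by auto
    have "(\<Sum>i<n. scale ((if i = j then c else 0) + u i) ((T ^^ i) v))
        = (\<Sum>i<n. if i = j then scale c ((T ^^ i) v) else 0) + y"
      unfolding u sum.distrib[symmetric]
      by (intro sum.cong refl) (simp add: scale_left_distrib)
    also have "\<dots> = scale c x + y" using j by simp
    finally show ?case by metis
  qed
  then obtain u where u: "b = (\<Sum>j<n. scale (u j) ((T ^^ j) v))" ..
  \<comment> \<open>The linear dependence of the iterates, read as a monic polynomial that sends the vector into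
      the subspace \<open>J\<close>.\<close>
  define p where "p = monom 1 n - (\<Sum>j<n. monom (u j) j)"
  have coeff_p: "coeff p i = (if i = n then 1 else if i < n then - u i else 0)" for i
    by (auto simp: p_def coeff_sum)
  have "p \<noteq> 0" using coeff_p[of n] by auto
  have "degree p \<le> n" by (rule degree_le) (simp add: coeff_p)
  then have "poly_apply p T v = (\<Sum>i\<le>n. scale (coeff p i) ((T ^^ i) v))"
    by (rule poly_apply_eq_sum)
  also have "\<dots> = (\<Sum>i<n. scale (coeff p i) ((T ^^ i) v)) + (T ^^ n) v"
    by (simp add: lessThan_Suc_atMost[symmetric] coeff_p)
  also have "(\<Sum>i<n. scale (coeff p i) ((T ^^ i) v)) = - b"
    unfolding u sum_negf[symmetric] by (intro sum.cong refl) (simp add: coeff_p)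
  finally have "poly_apply p T v \<in> J" using ab by simp
  then show ?thesis
    using eigenvector_mod_of_annihilating_poly[OF T E J \<open>p \<noteq> 0\<close>] assms(5,6) by blast
qed

end

section \<open>Lie's theorem for the adjoint representation\<close>

context complex_lie_algebra
begin

notation scale (infixr "\<cdot>" 75)

lemma ad_hom: "module_hom scale scale (bracket x)"
  by (simp add: module_hom_iff module_axioms bracket_add_right bracket_scale_right)

lemma ad_left_hom: "module_hom scale scale (\<lambda>x. bracket x y)"
  by (simp add: module_hom_iff module_axioms bracket_add_left bracket_scale_left)

lemmas bracket_zero_right [simp] = module_hom.zero[OF ad_hom]
lemmas bracket_zero_left [simp] = module_hom.zero[OF ad_left_hom]
lemmas bracket_diff_right = module_hom.diff[OF ad_hom]
lemmas bracket_minus_right = module_hom.neg[OF ad_hom]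

lemma bracket_anticomm: "bracket x y = - bracket y x"
proof -
  have "bracket (x + y) (x + y) = 0" by (rule bracket_self)
  then have "bracket x y + bracket y x = 0"
    unfolding bracket_add_left bracket_add_right by (simp add: bracket_self add.commute)
  then show ?thesis by (simp add: eq_neg_iff_add_eq_0)
qed

lemma jacobi_derivation:
  "bracket x (bracket y z) = bracket (bracket x y) z + bracket y (bracket x z)"
proof -
  have "bracket z (bracket x y) = - bracket (bracket x y) z"
    by (rule bracket_anticomm)
  moreover have "bracket y (bracket z x) = - bracket y (bracket x z)"
    by (simp add: bracket_anticomm[of z x] bracket_minus_right)
  ultimately show ?thesis using jacobi[of x y z] by (simp add: algebra_simps)
qed

lemma bracket_right_in_subspace:
  assumes "\<And>b. b \<in> S \<Longrightarrow> bracket x b \<in> W" "subspace W" "v \<in> span S"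
  shows "bracket x v \<in> W"
  using assms(3)
  by (induct rule: span_induct_alt)
    (simp_all add: assms subspace_0 bracket_add_right bracket_scale_right subspace_add subspace_scale)

lemma lie_ideal_subspace: "lie_ideal I \<Longrightarrow> subspace I"
  and lie_ideal_bracket: "lie_ideal I \<Longrightarrow> y \<in> I \<Longrightarrow> bracket x y \<in> I"
  by (auto simp: lie_ideal_def)

lemma lie_ideal_UNIV: "lie_ideal UNIV"
  by (simp add: lie_ideal_def)

lemma bracket_space_mono: "A \<subseteq> A' \<Longrightarrow> B \<subseteq> B' \<Longrightarrow> bracket_space A B \<subseteq> bracket_space A' B'"
  unfolding bracket_space_def by (rule span_mono) blast

lemma bracket_in_bracket_space: "x \<in> A \<Longrightarrow> y \<in> B \<Longrightarrow> bracket x y \<in> bracket_space A B"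
  unfolding bracket_space_def by (rule span_base) blast

lemma bracket_space_least:
  assumes "\<And>x y. x \<in> A \<Longrightarrow> y \<in> B \<Longrightarrow> bracket x y \<in> W" "subspace W"
  shows "bracket_space A B \<subseteq> W"
  unfolding bracket_space_def by (rule span_minimal) (use assms in auto)

lemma derived_series_Suc:
  "derived_series A (Suc k) = bracket_space (derived_series A k) (derived_series A k)"
  by (simp add: derived_series_def)

lemma subspace_derived_series: "subspace (derived_series UNIV k)"
  by (cases k) (simp_all add: derived_series_def bracket_space_def)

text \<open>
  Lie's theorem goes up the derived series one vector at a time. A bracket of two vectors in a term
  lies in the next, smaller term, so it stays among the vectors that were handled before.
\<close>

lemma derived_series_decreasing: "derived_series UNIV (Suc k) \<subseteq> derived_series UNIV k"
proof (induct k)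
  case 0
  then show ?case by (simp add: derived_series_def)
next
  case (Suc k)
  then show ?case unfolding derived_series_Suc[of _ "Suc k"] derived_series_Suc[of _ k]
    by (rule bracket_space_mono) (use Suc in \<open>simp_all add: derived_series_Suc\<close>)
qed

text \<open>
  A common eigenvector of all $\mathrm{ad}(k)$, $k \in K$, in the quotient by \<open>J\<close>. A vector of \<open>J\<close>
  satisfies this trivially, so \<open>v \<notin> J\<close> is always asked for separately.
\<close>

definition eigenvector_mod :: "'a set \<Rightarrow> 'a \<Rightarrow> 'a set \<Rightarrow> bool"
  where "eigenvector_mod K v J \<longleftrightarrow> (\<forall>k\<in>K. \<exists>c. bracket k v - c \<cdot> v \<in> J)"

lemma eigenvector_mod_span:
  assumes "eigenvector_mod S v J" "subspace J"
  shows "eigenvector_mod (span S) v J"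
  unfolding eigenvector_mod_def
proof
  fix k assume "k \<in> span S"
  then show "\<exists>c. bracket k v - c \<cdot> v \<in> J"
  proof (induct rule: span_induct_alt)
    case base
    show ?case by (rule exI[of _ 0]) (simp add: subspace_0 assms)
  next
    case (step a x y)
    then obtain c d where "bracket x v - c \<cdot> v \<in> J" "bracket y v - d \<cdot> v \<in> J"
      using assms unfolding eigenvector_mod_def by blast
    then have "a \<cdot> (bracket x v - c \<cdot> v) + (bracket y v - d \<cdot> v) \<in> J"
      using assms by (simp add: subspace_add subspace_scale)
    also have "a \<cdot> (bracket x v - c \<cdot> v) + (bracket y v - d \<cdot> v)
        = bracket (a \<cdot> x + y) v - (a * c + d) \<cdot> v"
      by (simp add: bracket_add_left bracket_scale_left scale_right_diff_distrib scale_left_distrib)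
    finally show ?case by blast
  qed
qed

end

locale solvable_lie_algebra = complex_lie_algebra scale bracket
  for scale :: "complex \<Rightarrow> 'a::ab_group_add \<Rightarrow> 'a" (infixr "\<cdot>" 75) and bracket +
  fixes ys :: "'a list"
  assumes ys_basis: "ordered_basis UNIV ys"
    and solvable: lie_solvable
begin

sublocale finite_dim_complex_space scale "set ys"
  by unfold_locales (use ys_basis in \<open>auto simp: ordered_basis_def\<close>)

text \<open>
  The heart of Lie's theorem, which makes weight spaces of \<open>K\<close> invariant under $\mathrm{ad}(x)$. The
  usual proof compares traces on the span of the $\mathrm{ad}(x)^i v$; here the coefficient of the
  second highest term is compared. Write $x_i = \mathrm{ad}(x)^i v$ and
  let $F_i$ be spanned by \<open>J\<close> and $x_0, \dots, x_{i-1}$. Moving $k$ past the $i$ copies of $x$ gives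
  $[k, x_i] \equiv \lambda(k) x_i + i \lambda([k,x]) x_{i-1}$ modulo $F_{i-1}$. For the least $n$
  with $x_n \in F_n$, the vector $x_n$ is a combination of lower terms, whence
  $[k, x_n] \equiv \lambda(k) x_n$ modulo $F_{n-1}$. Thus $n \lambda([k,x]) x_{n-1} \in F_{n-1}$,
  although $x_{n-1} \notin F_{n-1}$.
\<close>

lemma weight_vanishes_on_brackets:
  assumes J: "lie_ideal J" and v: "v \<notin> J"
    and Kx: "\<And>k. k \<in> K \<Longrightarrow> bracket k x \<in> K"
    and lam: "\<And>k. k \<in> K \<Longrightarrow> bracket k v - lam k \<cdot> v \<in> J"
    and k: "k \<in> K"
  shows "lam (bracket k x) = 0"
proof -
  let ?F = "krylov J (bracket x) v"
  let ?x = "\<lambda>i. (bracket x ^^ i) v"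
  have subJ: "subspace J" and JJ: "bracket z ` J \<subseteq> J" for z
    using J by (auto simp: lie_ideal_def)
  have F_step: "bracket x u \<in> ?F (Suc i)" if "u \<in> ?F i" for u i
    by (rule krylov_Suc_image[OF ad_hom JJ that])
  have J_F: "u \<in> ?F i" if "u \<in> J" for u i
    using subset_krylov[of J "bracket x" v i] that by blast
  have F_mono: "u \<in> ?F j" if "u \<in> ?F i" "i \<le> j" for u i j
    using krylov_mono[OF that(2), of J "bracket x" v] that(1) by blast
  have xF: "bracket x u \<in> ?F i" if "u \<in> ?F (i - 1)" for u i
  proof (cases i)
    case 0
    then show ?thesis using that JJ by (auto simp: krylov_0[OF subJ])
  next
    case (Suc m)
    then show ?thesis using that F_step by simp
  qed
  \<comment> \<open>For \<open>i = 0\<close> truncated subtraction is harmless: the term with \<open>?x (i - 1)\<close> has coefficient zero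
      and \<open>?F (i - 1)\<close> is \<open>J\<close>.\<close>
  have key: "bracket k (?x i) - lam k \<cdot> ?x i - (of_nat i * lam (bracket k x)) \<cdot> ?x (i - 1)
      \<in> ?F (i - 1)" if "k \<in> K" for k i
    using that
  proof (induct i arbitrary: k)
    case 0
    then show ?case using lam by (simp add: krylov_0[OF subJ])
  next
    case (Suc i)
    let ?h = "bracket k x" let ?l = "lam (bracket k x)"
    let ?A = "bracket k (?x i) - lam k \<cdot> ?x i - (of_nat i * ?l) \<cdot> ?x (i - 1)"
    let ?B = "bracket ?h (?x i) - ?l \<cdot> ?x i"
    have "bracket x ?A \<in> ?F i" by (rule xF[OF Suc.hyps[OF Suc.prems]])
    moreover have "?B \<in> ?F i"
    proof -
      let ?C = "(of_nat i * lam (bracket ?h x)) \<cdot> ?x (i - 1)"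
      have "?B - ?C \<in> ?F i"
        by (rule F_mono[OF Suc.hyps[OF Kx[OF Suc.prems]]]) simp
      moreover have "?C \<in> ?F i"
        by (cases i) (simp_all add: subspace_0 subspace_scale subspace_krylov funpow_in_krylov
            del: funpow.simps)
      ultimately have "(?B - ?C) + ?C \<in> ?F i"
        by (rule subspace_add[OF subspace_krylov])
      then show ?thesis by simp
    qed
    ultimately have "bracket x ?A + ?B \<in> ?F i"
      by (rule subspace_add[OF subspace_krylov])
    also have "bracket x ?A + ?B = bracket k (?x (Suc i)) - lam k \<cdot> ?x (Suc i)
        - (of_nat (Suc i) * ?l) \<cdot> ?x i"
    proof -
      have "bracket k (bracket x (?x i)) = bracket ?h (?x i) + bracket x (bracket k (?x i))"
        by (rule jacobi_derivation)
      moreover have "(of_nat i * ?l) \<cdot> bracket x (?x (i - 1)) = (of_nat i * ?l) \<cdot> ?x i"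
        by (cases i) simp_all
      ultimately show ?thesis
        by (simp add: bracket_diff_right bracket_scale_right distrib_right scale_left_distrib)
    qed
    finally show ?case by simp
  qed
  \<comment> \<open>By minimality the first \<open>n\<close> iterates are independent modulo \<open>J\<close>.\<close>
  define n where "n = (LEAST n. ?x n \<in> ?F n)"
  have n: "?x n \<in> ?F n"
    unfolding n_def using krylov_stabilizes by (rule LeastI_ex)
  have n_min: "?x i \<notin> ?F i" if "i < n" for i
    using not_less_Least that unfolding n_def by blast
  have "n \<noteq> 0"
    using n v by (intro notI) (simp add: krylov_0[OF subJ])
  then obtain m where m: "n = Suc m" by (cases n) auto
  have lower: "bracket k u - lam k \<cdot> u \<in> ?F m" if "u \<in> ?F n" for u
    using that unfolding krylov_def[of _ _ _ n]
  proof (induct rule: span_induct_alt)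
    case base
    then show ?case by (simp add: subspace_0 subspace_krylov)
  next
    case (step c u u')
    have "bracket k u - lam k \<cdot> u \<in> ?F m"
    proof (cases "u \<in> J")
      case True
      then show ?thesis using JJ subJ
        by (intro J_F subspace_diff subspace_scale) auto
    next
      case False
      then obtain j where j: "u = ?x j" "j \<le> m" using step(1) m by auto
      let ?C = "(of_nat j * lam (bracket k x)) \<cdot> ?x (j - 1)"
      have "bracket k u - lam k \<cdot> u - ?C \<in> ?F m"
        unfolding j by (rule F_mono[OF key[OF k]]) (use j in simp)
      moreover have "?C \<in> ?F m"
      proof (cases j)
        case (Suc l)
        then show ?thesis using j
          by (simp add: subspace_scale subspace_krylov funpow_in_krylov)
      qed (simp add: subspace_0 subspace_krylov)
      ultimately have "(bracket k u - lam k \<cdot> u - ?C) + ?C \<in> ?F m"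
        by (rule subspace_add[OF subspace_krylov])
      then show ?thesis by simp
    qed
    then have "c \<cdot> (bracket k u - lam k \<cdot> u) + (bracket k u' - lam k \<cdot> u') \<in> ?F m"
      using step(2) by (intro subspace_add[OF subspace_krylov] subspace_scale[OF subspace_krylov])
    also have "c \<cdot> (bracket k u - lam k \<cdot> u) + (bracket k u' - lam k \<cdot> u')
        = bracket k (c \<cdot> u + u') - lam k \<cdot> (c \<cdot> u + u')"
      by (simp add: bracket_add_right bracket_scale_right scale_right_distrib
          scale_right_diff_distrib mult.commute)
    finally show ?case .
  qed
  define a where "a = of_nat n * lam (bracket k x)"
  have "(bracket k (?x n) - lam k \<cdot> ?x n) - (bracket k (?x n) - lam k \<cdot> ?x n - a \<cdot> ?x m) \<in> ?F m"
    by (rule subspace_diff[OF subspace_krylov lower[OF n]])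
      (use key[OF k, of n] in \<open>simp add: a_def m\<close>)
  then have *: "a \<cdot> ?x m \<in> ?F m" by simp
  have "a = 0"
  proof (rule ccontr)
    assume "a \<noteq> 0"
    have "inverse a \<cdot> (a \<cdot> ?x m) \<in> ?F m" by (rule subspace_scale[OF subspace_krylov *])
    then show False using n_min[of m] m \<open>a \<noteq> 0\<close> by simp
  qed
  then show ?thesis using m by (simp add: a_def del: of_nat_Suc)
qed

text \<open>
  The vectors of \<open>I\<close> with the same weight \<open>lam\<close> for \<open>K\<close> form a subspace \<open>E\<close>, which
  $\mathrm{ad}(x)$ maps into itself because \<open>lam\<close> vanishes on $[K, x]$. An eigenvector of
  $\mathrm{ad}(x)$ in \<open>E\<close> modulo \<open>J\<close> is then an eigenvector for \<open>K\<close> and \<open>x\<close> together.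
\<close>

lemma eigenvector_mod_insert:
  assumes I: "lie_ideal I" and J: "lie_ideal J"
    and Kx: "\<And>k. k \<in> K \<Longrightarrow> bracket k x \<in> K"
    and v: "v \<in> I - J" "eigenvector_mod K v J"
  shows "\<exists>w\<in>I - J. eigenvector_mod (insert x K) w J"
proof -
  obtain lam where lam: "\<And>k. k \<in> K \<Longrightarrow> bracket k v - lam k \<cdot> v \<in> J"
    using v(2) unfolding eigenvector_mod_def by metis
  define E where "E = {w \<in> I. \<forall>k\<in>K. bracket k w - lam k \<cdot> w \<in> J}"
  have subI: "subspace I" and subJ: "subspace J" using I J by (auto simp: lie_ideal_def)
  have E: "subspace E"
  proof (rule subspaceI)
    show "0 \<in> E" by (simp add: E_def subspace_0 subI subJ)
  next
    fix w w' assume w: "w \<in> E" "w' \<in> E"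
    have "bracket k (w + w') - lam k \<cdot> (w + w') \<in> J" if "k \<in> K" for k
    proof -
      have "(bracket k w - lam k \<cdot> w) + (bracket k w' - lam k \<cdot> w') \<in> J"
        using w that by (intro subspace_add[OF subJ]) (auto simp: E_def)
      then show ?thesis by (simp add: bracket_add_right scale_right_distrib algebra_simps)
    qed
    then show "w + w' \<in> E" using w by (auto simp: E_def subspace_add[OF subI])
  next
    fix c w assume w: "w \<in> E"
    have "bracket k (c \<cdot> w) - lam k \<cdot> (c \<cdot> w) \<in> J" if "k \<in> K" for k
    proof -
      have "c \<cdot> (bracket k w - lam k \<cdot> w) \<in> J"
        using w that by (intro subspace_scale[OF subJ]) (auto simp: E_def)
      then show ?thesis by (simp add: bracket_scale_right scale_right_diff_distrib mult.commute)
    qed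
    then show "c \<cdot> w \<in> E" using w by (auto simp: E_def subspace_scale[OF subI])
  qed
  have "bracket x w \<in> E" if w: "w \<in> E" for w
  proof -
    have "bracket k (bracket x w) - lam k \<cdot> bracket x w \<in> J" if k: "k \<in> K" for k
    proof (cases "w \<in> J")
      case True
      then show ?thesis
        by (intro subspace_diff[OF subJ] subspace_scale[OF subJ] lie_ideal_bracket[OF J])
    next
      case False
      have "lam (bracket k x) = 0"
        by (rule weight_vanishes_on_brackets[OF J False Kx _ k]) (use w in \<open>auto simp: E_def\<close>)
      then have "bracket (bracket k x) w \<in> J"
        using w Kx[OF k] unfolding E_def by force
      moreover have "bracket x (bracket k w - lam k \<cdot> w) \<in> J"
        using w k by (intro lie_ideal_bracket[OF J]) (auto simp: E_def)
      ultimately have "bracket (bracket k x) w + bracket x (bracket k w - lam k \<cdot> w) \<in> J"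
        by (rule subspace_add[OF subJ])
      then show ?thesis
        unfolding jacobi_derivation[of k x w]
        by (simp add: bracket_diff_right bracket_scale_right add_diff_eq)
    qed
    then show ?thesis using w I by (auto simp: E_def lie_ideal_def)
  qed
  then have "bracket x ` E \<subseteq> E" by blast
  moreover have "v \<in> E" using v lam by (auto simp: E_def)
  ultimately obtain w c where w: "w \<in> E - J" "bracket x w - c \<cdot> w \<in> J"
    using eigenvector_mod_exists[OF ad_hom E _ subJ, of x v] v by blast
  then have "eigenvector_mod (insert x K) w J"
    unfolding eigenvector_mod_def E_def by blast
  then show ?thesis using w by (auto simp: E_def)
qed

text \<open>
  Lie's theorem in the form in which it builds flags of ideals: above every ideal \<open>J\<close> that does not
  contain \<open>I\<close> there is an ideal spanned by \<open>J\<close> and one vector of \<open>I\<close>. The proof climbs the derived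
  series from $\{0\}$ to the whole algebra, adding the members of a basis of each term one by one.
\<close>

theorem common_eigenvector_mod:
  assumes I: "lie_ideal I" and J: "lie_ideal J" and IJ: "\<not> I \<subseteq> J"
  shows "\<exists>v\<in>I - J. eigenvector_mod UNIV v J"
proof -
  have subJ: "subspace J" using J by (rule lie_ideal_subspace)
  let ?D = "derived_series UNIV"
  obtain d where d: "?D d = {0}" using solvable by (auto simp: lie_solvable_def)
  have "\<exists>v\<in>I - J. eigenvector_mod (?D k) v J" if "k \<le> d" for k
    using that
  proof (induct rule: inc_induct)
    case base
    show ?case using IJ unfolding d eigenvector_mod_def
      by (auto intro!: exI[of _ 0] simp: subspace_0[OF subJ])
  next
    case (step k)
    obtain B where B: "finite B" "B \<subseteq> ?D k" "span B = ?D k"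
      using basis_subspace_exists[OF subspace_derived_series] by metis
    have "\<exists>v\<in>I - J. eigenvector_mod (?D (Suc k) \<union> S) v J" if "finite S" "S \<subseteq> ?D k" for S
      using that
    proof (induct S)
      case empty
      then show ?case using step by simp
    next
      case (insert x S)
      then obtain v where v: "v \<in> I - J" "eigenvector_mod (?D (Suc k) \<union> S) v J" by auto
      have "bracket z x \<in> ?D (Suc k) \<union> S" if "z \<in> ?D (Suc k) \<union> S" for z
      proof -
        have "z \<in> ?D k" "x \<in> ?D k" using that insert derived_series_decreasing[of k] by auto
        then show ?thesis unfolding derived_series_Suc by (simp add: bracket_in_bracket_space)
      qed
      from eigenvector_mod_insert[OF I J this v] show ?case by simp
    qed
    from this[OF B(1,2)] obtain v where v: "v \<in> I - J" "eigenvector_mod (?D (Suc k) \<union> B) v J"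
      by blast
    then have "eigenvector_mod B v J" by (auto simp: eigenvector_mod_def)
    from eigenvector_mod_span[OF this subJ] show ?case using v B by auto
  qed
  from this[of 0] show ?thesis by (simp add: derived_series_def)
qed

end

section \<open>Triangularizing bases and the nilradical\<close>

context complex_lie_algebra
begin

lemma span_take_Suc:
  "j < length es \<Longrightarrow> span (set (take (Suc j) es)) = span (insert (es ! j) (set (take j es)))"
  by (simp add: take_Suc_conv_app_nth)

lemma span_take_mono: "i \<le> j \<Longrightarrow> span (set (take i es)) \<subseteq> span (set (take j es))"
  by (rule span_mono) (rule set_take_subset_set_take)

lemma nth_in_span_take: "i < j \<Longrightarrow> i < length es \<Longrightarrow> es ! i \<in> span (set (take j es))"
  by (rule span_base) (auto simp: in_set_conv_nth)

lemma ordered_basis_expansion: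
  assumes "ordered_basis V es" "w \<in> V"
  shows "w = (\<Sum>i<length es. representation (set es) w (es ! i) \<cdot> es ! i)"
proof -
  have es: "distinct es" "independent (set es)" "span (set es) = V"
    using assms by (auto simp: ordered_basis_def)
  have "w = (\<Sum>b\<in>set es. representation (set es) w b \<cdot> b)"
    by (rule sum_representation_eq[symmetric]) (use es assms in auto)
  also have "\<dots> = (\<Sum>b\<in>(!) es ` {..<length es}. representation (set es) w b \<cdot> b)"
    by (simp add: set_conv_nth image_def lessThan_def) (metis (lifting))
  also have "\<dots> = (\<Sum>i<length es. representation (set es) w (es ! i) \<cdot> es ! i)"
    using es(1) by (subst sum.reindex) (auto simp: inj_on_nth)
  finally show ?thesis .
qed

lemma representation_beyond_span_take:
  assumes "ordered_basis V es" "w \<in> span (set (take i es))" "i \<le> j" "j < length es"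
  shows "representation (set es) w (es ! j) = 0"
proof -
  have es: "distinct es" "independent (set es)"
    using assms by (auto simp: ordered_basis_def)
  have "representation (set es) w = representation (set (take i es)) w"
    by (rule representation_extend) (use es assms in \<open>auto dest: in_set_takeD\<close>)
  moreover have "es ! j \<notin> set (take i es)"
    using es assms(3,4) by (auto simp: in_set_conv_nth nth_eq_iff_index_eq)
  ultimately show ?thesis using representation_ne_zero by metis
qed

text \<open>
  Triangularity says that the spans of initial segments of the basis form a flag of ideals, and the
  diagonal entries are the scalars by which the algebra acts on the successive quotients. The
  diagonal entries are used through this description from here on; the next lemma is its converse.
\<close>

lemma triangularizing_basis_diag:
  assumes "triangularizing_basis I es" "lie_ideal I" "j < length es"
  shows "bracket y (es ! j) - ad_entry es y j j \<cdot> es ! j \<in> span (set (take j es))"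
proof -
  have es: "ordered_basis I es" and tri: "\<And>i. j < i \<Longrightarrow> i < length es \<Longrightarrow> ad_entry es y i j = 0"
    using assms by (auto simp: triangularizing_basis_def)
  have "es ! j \<in> I" using es assms(3) nth_mem span_base by (auto simp: ordered_basis_def)
  then have "bracket y (es ! j) \<in> I" using assms(2) lie_ideal_bracket by blast
  from ordered_basis_expansion[OF es this]
  have "bracket y (es ! j) = (\<Sum>i<length es. ad_entry es y i j \<cdot> es ! i)"
    by (simp add: ad_entry_def)
  also have "\<dots> = (\<Sum>i<Suc j. ad_entry es y i j \<cdot> es ! i)"
    by (rule sum.mono_neutral_right) (use assms(3) tri in auto)
  finally have "bracket y (es ! j) - ad_entry es y j j \<cdot> es ! j
      = (\<Sum>i<j. ad_entry es y i j \<cdot> es ! i)" by simp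
  also have "\<dots> \<in> span (set (take j es))"
    by (intro span_sum span_scale nth_in_span_take) (use assms(3) in auto)
  finally show ?thesis .
qed

lemma ad_entry_of_diag:
  assumes es: "ordered_basis V es" and j: "j < length es"
    and c: "bracket y (es ! j) - c \<cdot> es ! j \<in> span (set (take j es))"
  shows "ad_entry es y j j = c" and "\<And>i. j < i \<Longrightarrow> i < length es \<Longrightarrow> ad_entry es y i j = 0"
proof -
  let ?w = "bracket y (es ! j) - c \<cdot> es ! j"
  have ind: "independent (set es)" and dist: "distinct es" using es by (auto simp: ordered_basis_def)
  have w: "?w \<in> span (set es)" using c span_mono[OF set_take_subset] by blast
  have e: "es ! j \<in> span (set es)" using j span_base by simp
  have "representation (set es) (?w + c \<cdot> es ! j)
      = (\<lambda>b. representation (set es) ?w b + c * representation (set es) (es ! j) b)"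
    using representation_add[OF ind span_scale[OF e] w, of c] representation_scale[OF ind e, of c]
    by (simp add: add.commute)
  then have "ad_entry es y i j = representation (set es) ?w (es ! i)
      + c * (if es ! i = es ! j then 1 else 0)" for i
    using j ind by (simp add: ad_entry_def representation_basis)
  then have *: "ad_entry es y i j = c * (if i = j then 1 else 0)" if "j \<le> i" "i < length es" for i
    using representation_beyond_span_take[OF es c that] that j dist
    by (simp add: nth_eq_iff_index_eq)
  show "ad_entry es y j j = c" using * j by simp
  show "ad_entry es y i j = 0" if "j < i" "i < length es" for i using *[of i] that by simp
qed

lemma triangularizing_basisI:
  assumes "ordered_basis V es"
    and "\<And>y j. j < length es \<Longrightarrow> \<exists>c. bracket y (es ! j) - c \<cdot> es ! j \<in> span (set (take j es))"
  shows "triangularizing_basis V es"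
  unfolding triangularizing_basis_def
proof (intro conjI allI impI)
  fix y i j assume "j < i" "i < length es"
  moreover from this obtain c where "bracket y (es ! j) - c \<cdot> es ! j \<in> span (set (take j es))"
    using assms(2)[of j y] by auto
  ultimately show "ad_entry es y i j = 0"
    by (intro ad_entry_of_diag(2)[OF assms(1)]) auto
qed (rule assms(1))

lemma bracket_in_span_take_Suc:
  assumes "triangularizing_basis I es" "lie_ideal I" "j < length es"
  shows "bracket y (es ! j) \<in> span (set (take (Suc j) es))"
  using triangularizing_basis_diag[OF assms] unfolding span_take_Suc[OF assms(3)] span_insert by blast

lemma span_take_ideal:
  assumes "triangularizing_basis I es" "lie_ideal I"
  shows "lie_ideal (span (set (take i es)))"
  unfolding lie_ideal_def
proof (intro conjI allI ballI)
  fix x v assume v: "v \<in> span (set (take i es))"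
  show "bracket x v \<in> span (set (take i es))"
  proof (rule bracket_right_in_subspace[OF _ _ v])
    fix b assume "b \<in> set (take i es)"
    then obtain j where "b = es ! j" "j < i" "j < length es" by (auto simp: in_set_conv_nth)
    then show "bracket x b \<in> span (set (take i es))"
      using bracket_in_span_take_Suc[OF assms, of j x] span_take_mono[of "Suc j" i es] by auto
  qed simp
qed simp

lemma ad_entry_add:
  assumes "triangularizing_basis I es" "lie_ideal I" "i < length es"
  shows "ad_entry es (x + y) i i = ad_entry es x i i + ad_entry es y i i"
proof (rule ad_entry_of_diag(1))
  show "ordered_basis I es" using assms by (simp add: triangularizing_basis_def)
  have "(bracket x (es ! i) - ad_entry es x i i \<cdot> es ! i)
      + (bracket y (es ! i) - ad_entry es y i i \<cdot> es ! i) \<in> span (set (take i es))"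
    by (intro span_add triangularizing_basis_diag[OF assms])
  then show "bracket (x + y) (es ! i) - (ad_entry es x i i + ad_entry es y i i) \<cdot> es ! i
      \<in> span (set (take i es))"
    by (simp add: bracket_add_left scale_left_distrib algebra_simps)
qed (rule assms)

lemma ad_entry_scale:
  assumes "triangularizing_basis I es" "lie_ideal I" "i < length es"
  shows "ad_entry es (a \<cdot> x) i i = a * ad_entry es x i i"
proof (rule ad_entry_of_diag(1))
  show "ordered_basis I es" using assms by (simp add: triangularizing_basis_def)
  have "a \<cdot> (bracket x (es ! i) - ad_entry es x i i \<cdot> es ! i) \<in> span (set (take i es))"
    by (intro span_scale triangularizing_basis_diag[OF assms])
  then show "bracket (a \<cdot> x) (es ! i) - (a * ad_entry es x i i) \<cdot> es ! i \<in> span (set (take i es))"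
    by (simp add: bracket_scale_left scale_right_diff_distrib)
qed (rule assms)

text \<open>
  The scalars on a one-dimensional quotient commute.
\<close>

lemma ad_entry_bracket:
  assumes tri: "triangularizing_basis I es" "lie_ideal I" "i < length es"
  shows "ad_entry es (bracket x y) i i = 0"
proof (rule ad_entry_of_diag(1))
  show "ordered_basis I es" using assms by (simp add: triangularizing_basis_def)
  let ?e = "es ! i" let ?F = "span (set (take i es))"
  let ?a = "ad_entry es x i i" let ?b = "ad_entry es y i i"
  let ?x = "bracket x ?e - ?a \<cdot> ?e" let ?y = "bracket y ?e - ?b \<cdot> ?e"
  have xy: "?x \<in> ?F" "?y \<in> ?F" by (rule triangularizing_basis_diag[OF assms])+
  have "bracket x ?y + ?b \<cdot> ?x - (bracket y ?x + ?a \<cdot> ?y) \<in> ?F"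
    using lie_ideal_bracket[OF span_take_ideal[OF tri(1,2)] xy(2), of x]
      lie_ideal_bracket[OF span_take_ideal[OF tri(1,2)] xy(1), of y]
    by (rule span_diff[OF span_add[OF _ span_scale[OF xy(1)]] span_add[OF _ span_scale[OF xy(2)]]])
  also have "bracket x ?y + ?b \<cdot> ?x - (bracket y ?x + ?a \<cdot> ?y) = bracket (bracket x y) ?e"
    unfolding bracket_diff_right bracket_scale_right jacobi_derivation[of x y ?e]
    by (simp add: scale_right_diff_distrib mult.commute)
  finally show "bracket (bracket x y) ?e - 0 \<cdot> ?e \<in> ?F" by simp
qed (rule assms)

text \<open>
  For $x$ in a nilpotent ideal $\mathrm{ad}(x)$ is nilpotent on the whole algebra, since it maps the
  algebra into the ideal and then runs down the lower central series. A nilpotent triangular operator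
  has zero diagonal.
\<close>

lemma nilpotent_ideal_diag_zero:
  assumes tri: "triangularizing_basis UNIV es" and n: "lie_ideal \<nn>" "lie_nilpotent \<nn>"
    and x: "x \<in> \<nn>" and i: "i < length es"
  shows "ad_entry es x i i = 0"
proof (rule ccontr)
  let ?c = "ad_entry es x i i" let ?e = "es ! i" let ?F = "span (set (take i es))"
  assume c: "?c \<noteq> 0"
  obtain k where k: "lower_central_series \<nn> k = {0}" using n by (auto simp: lie_nilpotent_def)
  have lcs: "(bracket x ^^ Suc m) ?e \<in> lower_central_series \<nn> m" for m
  proof (induct m)
    case 0
    have "bracket ?e x \<in> \<nn>" by (rule lie_ideal_bracket[OF n(1) x])
    then have "- bracket ?e x \<in> \<nn>" by (rule subspace_neg[OF lie_ideal_subspace[OF n(1)]])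
    then show ?case by (simp add: lower_central_series_def bracket_anticomm[of x])
  next
    case (Suc m)
    then show ?case
      using bracket_in_bracket_space[OF x] by (simp add: lower_central_series_def)
  qed
  \<comment> \<open>Powers of a triangular operator have the powers of its diagonal entries on the diagonal.\<close>
  have diag: "(bracket x ^^ m) ?e - (?c ^ m) \<cdot> ?e \<in> ?F" for m
  proof (induct m)
    case (Suc m)
    let ?u = "(bracket x ^^ m) ?e - (?c ^ m) \<cdot> ?e"
    have "bracket x ?u + (?c ^ m) \<cdot> (bracket x ?e - ?c \<cdot> ?e) \<in> ?F"
      by (rule span_add[OF lie_ideal_bracket[OF span_take_ideal[OF tri lie_ideal_UNIV] Suc]
            span_scale[OF triangularizing_basis_diag[OF tri lie_ideal_UNIV i]]])
    then show ?case
      by (simp add: bracket_diff_right bracket_scale_right scale_right_diff_distrib mult.commute)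
  qed (simp add: span_zero)
  have "(bracket x ^^ Suc k) ?e = 0" using lcs[of k] k by simp
  define d where "d = ?c ^ Suc k"
  have "d \<noteq> 0" using c by (simp add: d_def)
  have "- (d \<cdot> ?e) \<in> ?F" using \<open>(bracket x ^^ Suc k) ?e = 0\<close> diag[of "Suc k"] by (simp add: d_def)
  then have "(- inverse d) \<cdot> (- (d \<cdot> ?e)) \<in> ?F" by (rule span_scale)
  then have e: "?e \<in> ?F" using \<open>d \<noteq> 0\<close> by simp
  have ob: "ordered_basis UNIV es" using tri by (simp add: triangularizing_basis_def)
  have "representation (set es) ?e ?e = 0"
    using representation_beyond_span_take[OF ob e order_refl i] .
  moreover have "representation (set es) ?e ?e = 1"
    using ob i by (simp add: ordered_basis_def representation_basis)
  ultimately show False by simp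
qed

text \<open>
  The elements with zero diagonal form an ideal, since brackets have zero diagonal. It is nilpotent,
  since its elements push each member of the flag into the preceding one. It contains every nilpotent
  ideal by the previous lemma, so it is the nilradical. Three facts rest on this theorem: brackets lie in
  the nilradical, weights vanish on it, and the weights have no common zero outside it.
\<close>

theorem nilradical_eq_diag_zero:
  assumes tri: "triangularizing_basis UNIV es" and n: "is_nilradical \<nn>"
  shows "\<nn> = {x. \<forall>i<length es. ad_entry es x i i = 0}"
proof -
  define N where "N = {x. \<forall>i<length es. ad_entry es x i i = 0}"
  note tri' = tri lie_ideal_UNIV
  have "subspace N"
  proof (rule subspaceI)
    show "0 \<in> N"
      using ad_entry_scale[OF tri', of _ 0 0] by (simp add: N_def)
  qed (simp_all add: N_def ad_entry_add[OF tri'] ad_entry_scale[OF tri'])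
  then have ideal: "lie_ideal N"
    by (simp add: lie_ideal_def) (simp add: N_def ad_entry_bracket[OF tri'])
  have lower: "bracket x v \<in> span (set (take m es))"
    if x: "x \<in> N" and v: "v \<in> span (set (take (Suc m) es))" for x v m
  proof (rule bracket_right_in_subspace[OF _ _ v])
    fix b assume "b \<in> set (take (Suc m) es)"
    then obtain j where j: "b = es ! j" "j \<le> m" "j < length es" by (auto simp: in_set_conv_nth)
    then have "bracket x b \<in> span (set (take j es))"
      using triangularizing_basis_diag[OF tri' j(3), of x] x by (simp add: N_def)
    then show "bracket x b \<in> span (set (take m es))" using span_take_mono[OF j(2)] by blast
  qed simp
  have lcs: "lower_central_series N k \<subseteq> span (set (take (length es - k) es))" for k
  proof (induct k)
    case 0
    have "span (set es) = UNIV" using tri by (simp add: triangularizing_basis_def ordered_basis_def)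
    then show ?case by simp
  next
    case (Suc k)
    have "lower_central_series N (Suc k) = bracket_space N (lower_central_series N k)"
      by (simp add: lower_central_series_def)
    also have "\<dots> \<subseteq> span (set (take (length es - Suc k) es))"
    proof (rule bracket_space_least)
      fix x y assume xy: "x \<in> N" "y \<in> lower_central_series N k"
      then have y: "y \<in> span (set (take (length es - k) es))" using Suc by blast
      show "bracket x y \<in> span (set (take (length es - Suc k) es))"
      proof (cases "k < length es")
        case True
        then have "length es - k = Suc (length es - Suc k)" by simp
        then show ?thesis using lower[OF xy(1)] y by simp
      next
        case False
        then show ?thesis using y by (simp add: span_zero)
      qed
    qed simp
    finally show ?case .
  qed
  have "lower_central_series N (length es) = {0}"
  proof
    show "lower_central_series N (length es) \<subseteq> {0}" using lcs[of "length es"] by simp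
    have "subspace (lower_central_series N (length es))"
      by (cases "length es")
        (simp_all add: lower_central_series_def bracket_space_def \<open>subspace N\<close>)
    then show "{0} \<subseteq> lower_central_series N (length es)" using subspace_0 by blast
  qed
  then have "lie_nilpotent N" by (auto simp: lie_nilpotent_def)
  moreover have "\<nn> \<subseteq> N"
    using nilpotent_ideal_diag_zero[OF tri] n by (auto simp: is_nilradical_def N_def)
  ultimately have "N = \<nn>" using n ideal by (simp add: is_nilradical_def)
  then show ?thesis by (simp add: N_def)
qed

end

context solvable_lie_algebra
begin

text \<open>
  Each application of Lie's theorem adds one vector to the flag.
\<close>

theorem triangularizing_basis_exists:
  assumes I: "lie_ideal I"
  shows "\<exists>es. triangularizing_basis I es"
proof -
  let ?P = "\<lambda>es. distinct es \<and> independent (set es) \<and> set es \<subseteq> I \<and>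
    (\<forall>y. \<forall>j<length es. \<exists>c. bracket y (es ! j) - c \<cdot> es ! j \<in> span (set (take j es)))"
  have subI: "subspace I" using I by (rule lie_ideal_subspace)
  have "\<exists>es. length es = n \<and> ?P es" if "n \<le> dim I" for n
    using that
  proof (induct n)
    case 0
    show ?case by (rule exI[of _ "[]"]) (simp add: independent_empty)
  next
    case (Suc n)
    then obtain es where es: "length es = n" "?P es" by auto
    let ?J = "span (set es)"
    have JI: "?J \<subseteq> I" using es subI by (simp add: span_minimal)
    have "triangularizing_basis ?J es"
      by (rule triangularizing_basisI) (use es in \<open>auto simp: ordered_basis_def\<close>)
    moreover have "lie_ideal ?J"
      unfolding lie_ideal_def
    proof (intro conjI allI ballI)
      fix x v assume v: "v \<in> ?J"
      show "bracket x v \<in> ?J"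
      proof (rule bracket_right_in_subspace[OF _ _ v])
        fix b assume "b \<in> set es"
        then obtain j where j: "b = es ! j" "j < length es" by (auto simp: in_set_conv_nth)
        then obtain c where "bracket x b - c \<cdot> b \<in> span (set (take j es))" using es by blast
        then have "bracket x b - c \<cdot> b \<in> ?J" using span_mono[OF set_take_subset] by blast
        moreover have "c \<cdot> b \<in> ?J" using j by (intro span_scale span_base) auto
        ultimately have "(bracket x b - c \<cdot> b) + c \<cdot> b \<in> ?J" by (rule span_add)
        then show "bracket x b \<in> ?J" by simp
      qed simp
    qed simp
    moreover have "\<not> I \<subseteq> ?J"
    proof
      assume "I \<subseteq> ?J"
      then have "dim I \<le> card (set es)" by (rule dim_le_card) simp
      then show False using es Suc.prems by (simp add: distinct_card)
    qed
    ultimately obtain v where v: "v \<in> I" "v \<notin> ?J" "eigenvector_mod UNIV v ?J"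
      using common_eigenvector_mod[OF I, of ?J] by blast
    have "?P (es @ [v])"
    proof (intro conjI allI impI)
      show "distinct (es @ [v])" using es v span_base by auto
      show "independent (set (es @ [v]))" using es v by (simp add: independent_insertI)
      show "set (es @ [v]) \<subseteq> I" using es v by simp
      fix y j assume "j < length (es @ [v])"
      then consider "j < length es" | "j = length es" by fastforce
      then show "\<exists>c. bracket y ((es @ [v]) ! j) - c \<cdot> (es @ [v]) ! j
          \<in> span (set (take j (es @ [v])))"
      proof cases
        case 1
        then show ?thesis using es by (simp add: nth_append)
      next
        case 2
        then show ?thesis using v(3) by (simp add: eigenvector_mod_def)
      qed
    qed
    then show ?case using es by (intro exI[of _ "es @ [v]"]) simp
  qed
  from this[of "dim I"] obtain es where es: "length es = dim I" "?P es" by blast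
  have "I \<subseteq> span (set es)"
    by (rule card_ge_dim_independent) (use es in \<open>auto simp: distinct_card\<close>)
  then have "span (set es) = I" using es subI by (simp add: span_minimal subset_antisym)
  then have "triangularizing_basis I es"
    by (intro triangularizing_basisI) (use es in \<open>auto simp: ordered_basis_def\<close>)
  then show ?thesis ..
qed

lemma bracket_in_nilradical:
  assumes n: "is_nilradical \<nn>"
  shows "bracket x y \<in> \<nn>"
proof -
  obtain es where tri: "triangularizing_basis UNIV es"
    using triangularizing_basis_exists[OF lie_ideal_UNIV] ..
  show ?thesis
    unfolding nilradical_eq_diag_zero[OF tri n]
    by (simp add: ad_entry_bracket[OF tri lie_ideal_UNIV])
qed

lemma ordered_basis_append:
  assumes W: "ordered_basis W es" and V: "ordered_basis V fs" and c: "is_complement W V"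
  shows "ordered_basis UNIV (es @ fs)"
proof -
  have sub: "subspace W" "subspace V" using W V by (auto simp: ordered_basis_def)
  have es: "distinct es" "independent (set es)" "span (set es) = W"
    and fs: "distinct fs" "independent (set fs)" "span (set fs) = V"
    using W V by (auto simp: ordered_basis_def)
  have WV: "W \<inter> V = {0}" "{w + v |w v. w \<in> W \<and> v \<in> V} = UNIV"
    using c by (auto simp: is_complement_def)
  have "dim (UNIV :: 'a set) = card (set es) + card (set fs)"
    using dim_sums_Int[OF sub] WV es fs
    by (metis add.right_neutral dim_span_eq_card_independent dim_eq_0 subset_refl)
  moreover have disj: "set es \<inter> set fs = {}"
  proof -
    have "set es \<inter> set fs \<subseteq> W \<inter> V" using es fs span_superset by blast
    moreover have "0 \<notin> set es" using es dependent_zero by blast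
    ultimately show ?thesis using WV by auto
  qed
  moreover have span: "span (set (es @ fs)) = UNIV"
    unfolding set_append span_Un es fs by (rule WV)
  ultimately have "independent (set (es @ fs))"
    by (intro card_le_dim_spanning[of _ UNIV]) (auto simp: card_Un_disjoint)
  then show ?thesis using es fs disj span by (simp add: ordered_basis_def)
qed

text \<open>
  Since all brackets lie in the nilradical, any basis of the complement may be appended to a
  triangularizing basis of the nilradical, and it adds only zeros to the diagonal.
\<close>

lemma triangularizing_basis_append:
  assumes n: "is_nilradical \<nn>" and tri: "triangularizing_basis \<nn> es"
    and V: "ordered_basis V fs" and c: "is_complement \<nn> V"
  shows "triangularizing_basis UNIV (es @ fs)" (is ?tri)
    and "i < length es \<Longrightarrow> ad_entry (es @ fs) y i i = ad_entry es y i i" (is "_ \<Longrightarrow> ?l")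
    and "length es \<le> i \<Longrightarrow> i < length (es @ fs) \<Longrightarrow> ad_entry (es @ fs) y i i = 0"
      (is "_ \<Longrightarrow> _ \<Longrightarrow> ?r")
proof -
  have I: "lie_ideal \<nn>" using n by (simp add: is_nilradical_def)
  have ob: "ordered_basis \<nn> es" using tri by (simp add: triangularizing_basis_def)
  have ob': "ordered_basis UNIV (es @ fs)"
    by (rule ordered_basis_append[OF ob V c])
  have left: "bracket y ((es @ fs) ! i) - ad_entry es y i i \<cdot> (es @ fs) ! i
      \<in> span (set (take i (es @ fs)))" if "i < length es" for i y
    using triangularizing_basis_diag[OF tri I that, of y] that by (simp add: nth_append)
  have right: "bracket y ((es @ fs) ! i) - 0 \<cdot> (es @ fs) ! i
      \<in> span (set (take i (es @ fs)))" if "length es \<le> i" for i y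
  proof -
    have "bracket y ((es @ fs) ! i) \<in> span (set es)"
      using bracket_in_nilradical[OF n] ob by (simp add: ordered_basis_def)
    moreover have "span (set es) \<subseteq> span (set (take i (es @ fs)))"
      by (rule span_mono) (use that in auto)
    ultimately show ?thesis by auto
  qed
  show ?tri by (rule triangularizing_basisI[OF ob']) (use left right not_le in blast)
  show ?l if "i < length es" using left[OF that] that by (intro ad_entry_of_diag(1)[OF ob']) auto
  show ?r if "length es \<le> i" "i < length (es @ fs)"
    by (rule ad_entry_of_diag(1)[OF ob' that(2) right[OF that(1)]])
qed

end

section \<open>Linear factors of polynomials\<close>

lemma pconst_0: "pconst 0 = 0"
  and pconst_1: "pconst 1 = 1"
  and pconst_add: "pconst (a + b) = pconst a + pconst b"
  and pconst_diff: "pconst (a - b) = pconst a - pconst b"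
  and pconst_mult: "pconst (a * b) = pconst a * pconst b"
  by (simp_all add: pconst_def single_add single_diff mult_single)

lemma pconst_sum: "pconst (sum f A) = (\<Sum>i\<in>A. pconst (f i))"
  by (induct A rule: infinite_finite_induct) (simp_all add: pconst_0 pconst_add)

definition monomial_subst :: "(nat \<Rightarrow> cpoly) \<Rightarrow> (nat \<Rightarrow>\<^sub>0 nat) \<Rightarrow> cpoly"
  where "monomial_subst f m = (\<Prod>i\<in>Poly_Mapping.keys m. f i ^ Poly_Mapping.lookup m i)"

text \<open>
  The ring endomorphism of the polynomial ring that sends the variable $z_i$ to \<open>f i\<close>.
\<close>

definition subst :: "(nat \<Rightarrow> cpoly) \<Rightarrow> cpoly \<Rightarrow> cpoly"
  where "subst f p = (\<Sum>m\<in>Poly_Mapping.keys p. pconst (Poly_Mapping.lookup p m) * monomial_subst f m)"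

lemma monomial_subst_add: "monomial_subst f (m + m') = monomial_subst f m * monomial_subst f m'"
proof -
  have *: "monomial_subst f l = (\<Prod>i\<in>Poly_Mapping.keys m \<union> Poly_Mapping.keys m'. f i ^ Poly_Mapping.lookup l i)"
    if "Poly_Mapping.keys l \<subseteq> Poly_Mapping.keys m \<union> Poly_Mapping.keys m'" for l
    unfolding monomial_subst_def
    by (rule prod.mono_neutral_left) (use that in \<open>auto simp: in_keys_iff\<close>)
  show ?thesis
    by (subst (1 2 3) *) (simp_all add: keys_add lookup_add power_add prod.distrib)
qed

lemma subst_single: "subst f (Poly_Mapping.single m c) = pconst c * monomial_subst f m"
  by (simp add: subst_def pconst_0)

lemma subst_0: "subst f 0 = 0"
  by (simp add: subst_def)

lemma subst_add: "subst f (p + q) = subst f p + subst f q"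
  unfolding subst_def
  by (rule setsum_keys_plus_distrib) (simp_all add: pconst_0 pconst_add distrib_right)

lemma subst_sum: "subst f (sum g A) = (\<Sum>i\<in>A. subst f (g i))"
  by (induct A rule: infinite_finite_induct) (simp_all add: subst_0 subst_add)

lemma sum_of_terms: "p = (\<Sum>m\<in>Poly_Mapping.keys p. Poly_Mapping.single m (Poly_Mapping.lookup p m))"
  by (rule poly_mapping_eqI) (simp add: lookup_sum lookup_single when_def in_keys_iff)

lemma subst_mult: "subst f (p * q) = subst f p * subst f q"
proof -
  let ?s = Poly_Mapping.single
  have *: "subst f (?s m c * ?s m' c') = subst f (?s m c) * subst f (?s m' c')" for m c m' c'
    by (simp add: mult_single subst_single monomial_subst_add pconst_mult mult.assoc mult.left_commute)
  have "p * q = (\<Sum>m\<in>Poly_Mapping.keys p. \<Sum>m'\<in>Poly_Mapping.keys q. ?s m (Poly_Mapping.lookup p m) * ?s m' (Poly_Mapping.lookup q m'))"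
    unfolding sum_product[symmetric] sum_of_terms[symmetric] ..
  then have "subst f (p * q) = (\<Sum>m\<in>Poly_Mapping.keys p. \<Sum>m'\<in>Poly_Mapping.keys q.
      subst f (?s m (Poly_Mapping.lookup p m)) * subst f (?s m' (Poly_Mapping.lookup q m')))"
    by (simp only: subst_sum *)
  also have "\<dots> = subst f p * subst f q"
    unfolding sum_product[symmetric] subst_sum[symmetric] sum_of_terms[symmetric] ..
  finally show ?thesis .
qed

lemma subst_pconst: "subst f (pconst c) = pconst c"
  by (simp add: pconst_def subst_single monomial_subst_def)

lemma subst_pvar: "subst f (pvar i) = f i"
  by (simp add: pvar_def subst_single monomial_subst_def pconst_1)

lemma monomial_subst_pvar: "monomial_subst pvar m = Poly_Mapping.single m 1"
proof -
  have pow: "pvar i ^ n = Poly_Mapping.single (Poly_Mapping.single i n) 1" for i n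
    by (induct n) (simp_all add: pvar_def mult_single flip: single_add)
  have prod: "(\<Prod>i\<in>A. Poly_Mapping.single (g i) 1) = (Poly_Mapping.single (sum g A) 1 :: cpoly)"
    if "finite A" for A :: "nat set" and g
    using that by induct (simp_all add: mult_single)
  show ?thesis
    unfolding monomial_subst_def pow prod[OF finite_keys]
    by (rule arg_cong2[where f = Poly_Mapping.single, OF _ refl])
      (rule poly_mapping_eqI, simp add: lookup_sum lookup_single when_def in_keys_iff)
qed

lemma dvd_diff_power:
  fixes a b :: "'a::comm_ring_1"
  assumes "d dvd a - b"
  shows "d dvd a ^ n - b ^ n"
  using assms power_diff_sumr2[of a n b] by simp

lemma dvd_diff_prod:
  fixes a b :: "'i \<Rightarrow> 'a::comm_ring_1"
  assumes "\<And>i. i \<in> A \<Longrightarrow> d dvd a i - b i"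
  shows "d dvd prod a A - prod b A"
  using assms
proof (induct A rule: infinite_finite_induct)
  case (insert i A)
  have "d dvd (a i - b i) * prod a A + b i * (prod a A - prod b A)"
    using insert by (intro dvd_add dvd_mult dvd_mult2) auto
  then show ?case using insert by (simp add: algebra_simps)
qed simp_all

text \<open>
  Modulo \<open>d\<close>, replacing each variable by a congruent polynomial changes nothing.
\<close>

lemma dvd_diff_subst:
  assumes "\<And>i. d dvd pvar i - f i"
  shows "d dvd p - subst f p"
proof -
  have "Poly_Mapping.single m c = pconst c * monomial_subst pvar m" for m c
    by (simp add: monomial_subst_pvar pconst_def mult_single)
  then have "p = (\<Sum>m\<in>Poly_Mapping.keys p. pconst (Poly_Mapping.lookup p m) * monomial_subst pvar m)"
    using sum_of_terms[of p] by simp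
  then have "p - subst f p
      = (\<Sum>m\<in>Poly_Mapping.keys p. pconst (Poly_Mapping.lookup p m) * (monomial_subst pvar m - monomial_subst f m))"
    unfolding subst_def right_diff_distrib sum_subtractf by simp
  also have "d dvd \<dots>"
    unfolding monomial_subst_def
    by (intro dvd_sum dvd_mult dvd_diff_prod dvd_diff_power assms)
  finally show ?thesis .
qed

definition linear_form :: "nat \<Rightarrow> (nat \<Rightarrow> complex) \<Rightarrow> cpoly"
  where "linear_form n a = pvar 0 + (\<Sum>i<n. pvar (Suc i) * pconst (a i))"

text \<open>
  The substitution that solves \<open>linear_form n a = 0\<close> for $z_0$ and fixes the other variables. The
  linear form generates its kernel, which makes the form prime and settles which linear forms divide
  each other.
\<close>

definition eliminate :: "nat \<Rightarrow> (nat \<Rightarrow> complex) \<Rightarrow> nat \<Rightarrow> cpoly"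
  where "eliminate n a i = (if i = 0 then - (\<Sum>i<n. pvar (Suc i) * pconst (a i)) else pvar i)"

lemma subst_eliminate_linear_form:
  "subst (eliminate n a) (linear_form n b) = (\<Sum>i<n. pvar (Suc i) * pconst (b i - a i))"
  by (simp add: linear_form_def subst_add subst_sum subst_mult subst_pvar subst_pconst
      eliminate_def pconst_diff right_diff_distrib sum_subtractf)

lemma linear_form_dvd_iff: "linear_form n a dvd p \<longleftrightarrow> subst (eliminate n a) p = 0"
proof
  assume "linear_form n a dvd p"
  then show "subst (eliminate n a) p = 0"
    by (auto simp: dvd_def subst_mult subst_eliminate_linear_form pconst_0)
next
  assume "subst (eliminate n a) p = 0"
  moreover have "linear_form n a dvd pvar i - eliminate n a i" for i
    by (simp add: eliminate_def linear_form_def)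
  then have "linear_form n a dvd p - subst (eliminate n a) p" by (rule dvd_diff_subst)
  ultimately show "linear_form n a dvd p" by simp
qed

lemma linear_form_dvd_mult:
  "linear_form n a dvd p * q \<Longrightarrow> linear_form n a dvd p \<or> linear_form n a dvd q"
  by (simp add: linear_form_dvd_iff subst_mult)

lemma lookup_linear_combination:
  assumes "j < n"
  shows "Poly_Mapping.lookup (\<Sum>i<n. pvar (Suc i) * pconst (a i)) (Poly_Mapping.single (Suc j) 1) = a j"
proof -
  have inj: "Poly_Mapping.single (Suc i) (1::nat) = Poly_Mapping.single (Suc j) 1 \<longleftrightarrow> i = j" for i
    by (auto dest: arg_cong[where f = Poly_Mapping.keys])
  have "Poly_Mapping.lookup (pvar (Suc i) * pconst (a i)) (Poly_Mapping.single (Suc j) 1)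
      = (if i = j then a i else 0)" for i
    by (simp add: pvar_def pconst_def mult_single lookup_single inj[simplified] when_def)
  then show ?thesis using assms by (simp add: lookup_sum)
qed

lemma linear_form_dvd_linear_form_iff:
  "linear_form n a dvd linear_form n b \<longleftrightarrow> (\<forall>i<n. a i = b i)"
proof
  assume "linear_form n a dvd linear_form n b"
  then have *: "(\<Sum>i<n. pvar (Suc i) * pconst (b i - a i)) = 0"
    by (simp add: linear_form_dvd_iff subst_eliminate_linear_form)
  show "\<forall>i<n. a i = b i"
  proof (intro allI impI)
    fix i assume "i < n"
    then show "a i = b i"
      using lookup_linear_combination[of i n "\<lambda>i. b i - a i"] unfolding * by simp
  qed
qed (simp add: linear_form_def)

lemma linear_form_not_unit: "\<not> linear_form n a dvd 1"
  using subst_pconst[of _ 1] by (simp add: linear_form_dvd_iff pconst_1)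

text \<open>
  A nonzero nonunit that divides a product only if it divides a factor is irreducible.
\<close>

lemma linear_form_irreducible: "Factorial_Ring.irreducible (linear_form n a)"
proof -
  \<comment> \<open>Evaluation at $z_0 = 1$ and all other variables zero shows that the form is not zero.\<close>
  have "subst (\<lambda>i. if i = 0 then 1 else 0) (linear_form n a) = 1"
    by (simp add: linear_form_def subst_add subst_sum subst_mult subst_pvar)
  then have nz: "linear_form n a \<noteq> 0" by (auto simp: subst_0)
  have "p dvd 1 \<or> q dvd 1" if pq: "linear_form n a = p * q" for p q
  proof -
    have unit: "v dvd 1" if uv: "linear_form n a = u * v" "linear_form n a dvd u" for u v
    proof -
      obtain w where w: "u = linear_form n a * w" using uv(2) by (rule dvdE)
      have "linear_form n a * (w * v) = linear_form n a * 1"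
        unfolding mult_1_right by (rule uv(1)[unfolded w mult.assoc, symmetric])
      then have "w * v = 1" using nz mult_cancel_left by blast
      then show ?thesis by (metis dvd_triv_right)
    qed
    have "linear_form n a dvd p \<or> linear_form n a dvd q"
      by (rule linear_form_dvd_mult) (simp add: pq)
    then show ?thesis using unit[OF pq] unit[OF pq[unfolded mult.commute[of p]]] by blast
  qed
  then show ?thesis using nz linear_form_not_unit by (auto simp: irreducible_def)
qed

text \<open>
  Each linear form is prime. If the product is \<open>p * q\<close>, a given form therefore divides \<open>p\<close> and is its
  associate, or it divides \<open>q\<close> and can be cancelled from both sides.
\<close>

lemma irreducible_dvd_prod_linear_forms:
  assumes "finite A" and p: "Factorial_Ring.irreducible p"
    and "p dvd (\<Prod>i\<in>A. linear_form n (a i))"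
  shows "\<exists>i\<in>A. associates p = associates (linear_form n (a i))"
  using assms(1,3)
proof (induct A)
  case empty
  then show ?case using p by (simp add: irreducible_def)
next
  case (insert i A)
  let ?L = "linear_form n (a i)" and ?r = "\<Prod>i\<in>A. linear_form n (a i)"
  obtain q where q: "?L * ?r = p * q" using insert by (auto simp: dvd_def)
  then have "?L dvd p * q" by (metis dvd_triv_left)
  then consider "?L dvd p" | "?L dvd q" using linear_form_dvd_mult by blast
  then show ?case
  proof cases
    case 1
    then obtain u where u: "p = ?L * u" by (auto simp: dvd_def)
    then have "u dvd 1" using p linear_form_not_unit by (auto simp: irreducible_def)
    then have "p dvd ?L"
      unfolding u by (metis dvd_refl mult.right_neutral mult_dvd_mono)
    with 1 have "associates p = associates ?L"
      unfolding associates_def by (auto intro: dvd_trans)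
    then show ?thesis by blast
  next
    case 2
    then obtain w where "q = ?L * w" by (auto simp: dvd_def)
    then have "?L * ?r = ?L * (p * w)" using q by (simp add: mult.left_commute)
    moreover have "?L \<noteq> 0" using linear_form_irreducible[of n "a i"] by (auto simp: irreducible_def)
    ultimately have "?r = p * w" using mult_cancel_left by blast
    then show ?thesis using insert by auto
  qed
qed

theorem num_irreducible_factors_prod_linear_forms:
  assumes "finite A"
  shows "num_irreducible_factors (\<Prod>i\<in>A. linear_form n (a i))
    = card ((\<lambda>i. linear_form n (a i)) ` A)"
proof -
  let ?L = "\<lambda>i. linear_form n (a i)"
  have "associates ` {p. Factorial_Ring.irreducible p \<and> p dvd (\<Prod>i\<in>A. ?L i)} = associates ` ?L ` A"
  proof
    show "associates ` {p. Factorial_Ring.irreducible p \<and> p dvd (\<Prod>i\<in>A. ?L i)}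
        \<subseteq> associates ` ?L ` A"
      using irreducible_dvd_prod_linear_forms[OF assms] by blast
    show "associates ` ?L ` A
        \<subseteq> associates ` {p. Factorial_Ring.irreducible p \<and> p dvd (\<Prod>i\<in>A. ?L i)}"
      using linear_form_irreducible assms by auto
  qed
  moreover have "inj_on associates (?L ` A)"
  proof (rule inj_onI)
    fix p q assume "p \<in> ?L ` A" "q \<in> ?L ` A" and pq: "associates p = associates q"
    then obtain i j where ij: "p = ?L i" "q = ?L j" by auto
    have "p \<in> associates q" unfolding pq[symmetric] by (simp add: associates_def)
    then have "p dvd q" by (simp add: associates_def)
    then have "\<And>k. k < n \<Longrightarrow> a i k = a j k"
      unfolding ij linear_form_dvd_linear_form_iff by blast
    then show "p = q" unfolding ij linear_form_def by simp
  qed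
  ultimately show ?thesis
    by (simp add: num_irreducible_factors_def card_image)
qed

section \<open>The characteristic polynomial of a solvable Lie algebra\<close>

context complex_lie_algebra
begin

lemma representation_ad:
  assumes bs: "ordered_basis UNIV bs"
  shows "representation (set bs) (bracket y v) b
    = (\<Sum>l<length bs. representation (set bs) (bracket y (bs ! l)) b * representation (set bs) v (bs ! l))"
proof -
  interpret ad: module_hom scale scale "bracket y" by (rule ad_hom)
  have bs': "independent (set bs)" "span (set bs) = UNIV"
    using bs by (auto simp: ordered_basis_def)
  have "bracket y v = bracket y (\<Sum>l<length bs. representation (set bs) v (bs ! l) \<cdot> bs ! l)"
    using ordered_basis_expansion[OF bs UNIV_I[of v]] by simp
  also have "\<dots> = (\<Sum>l<length bs. representation (set bs) v (bs ! l) \<cdot> bracket y (bs ! l))"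
    by (simp add: ad.sum ad.scale)
  finally show ?thesis
    using bs' by (simp add: representation_sum representation_scale mult.commute)
qed

lemma representation_change_basis:
  assumes bs: "ordered_basis UNIV bs" and ys: "ordered_basis UNIV ys"
  shows "representation (set bs) v b
    = (\<Sum>l<length ys. representation (set bs) (ys ! l) b * representation (set ys) v (ys ! l))"
proof -
  have bs': "independent (set bs)" "span (set bs) = UNIV"
    using bs by (auto simp: ordered_basis_def)
  have "representation (set bs) v b
      = representation (set bs) (\<Sum>l<length ys. representation (set ys) v (ys ! l) \<cdot> ys ! l) b"
    using ordered_basis_expansion[OF ys UNIV_I[of v]] by simp
  then show ?thesis
    using bs' by (simp add: representation_sum representation_scale mult.commute)
qed

text \<open>
  The matrix of $z_0 I + \sum_i z_i\,\mathrm{ad}\,y_i$ in a basis \<open>bs\<close> that need not be the list \<open>ys\<close>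
  that pairs the variables with operators. Changing \<open>bs\<close> keeps the determinant, and \<open>bs\<close> can then be
  triangularizing.
\<close>

definition lie_char_mat :: "'a list \<Rightarrow> 'a list \<Rightarrow> cpoly mat"
  where "lie_char_mat ys bs = mat (length bs) (length bs)
      (\<lambda>(k, j). (if k = j then pvar 0 else 0) +
        (\<Sum>i<length ys. pvar (Suc i) * pconst (ad_entry bs (ys ! i) k j)))"

text \<open>
  An entry of the product of the matrix of the pencil with another matrix, with the coefficient of
  each variable collected.
\<close>

lemma sum_pencil_mult:
  fixes z :: "'r::comm_semiring_1" and k n r :: nat
  assumes "k < n"
  shows "(\<Sum>l<n. ((if k = l then z else 0) + (\<Sum>i<r. x i * c i l)) * d l)
    = z * d k + (\<Sum>i<r. x i * (\<Sum>l<n. c i l * d l))"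
proof -
  have "((if k = l then z else 0) + (\<Sum>i<r. x i * c i l)) * d l
      = (if k = l then z * d l else 0) + (\<Sum>i<r. x i * (c i l * d l))" for l
    by (simp add: distrib_right sum_distrib_right mult.assoc)
  then have "(\<Sum>l<n. ((if k = l then z else 0) + (\<Sum>i<r. x i * c i l)) * d l)
      = z * d k + (\<Sum>l<n. \<Sum>i<r. x i * (c i l * d l))"
    using assms by (simp add: sum.distrib)
  also have "(\<Sum>l<n. \<Sum>i<r. x i * (c i l * d l)) = (\<Sum>i<r. x i * (\<Sum>l<n. c i l * d l))"
    by (subst sum.swap) (simp add: sum_distrib_left)
  finally show ?thesis .
qed

lemma det_lie_char_mat_change_basis:
  assumes bs: "ordered_basis UNIV bs" and ys: "ordered_basis UNIV ys"
    and len: "length bs = length ys"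
  shows "det (lie_char_mat ys ys) = det (lie_char_mat ys bs)"
proof -
  let ?n = "length ys"
  define P :: "cpoly mat"
    where "P = mat ?n ?n (\<lambda>(k, j). pconst (representation (set bs) (ys ! j) (bs ! k)))"
  define Q :: "cpoly mat"
    where "Q = mat ?n ?n (\<lambda>(k, j). pconst (representation (set ys) (bs ! j) (ys ! k)))"
  let ?A = "lie_char_mat ys ys" and ?B = "lie_char_mat ys bs"
  have carrier: "P \<in> carrier_mat ?n ?n" "Q \<in> carrier_mat ?n ?n"
    "?A \<in> carrier_mat ?n ?n" "?B \<in> carrier_mat ?n ?n"
    by (simp_all add: P_def Q_def lie_char_mat_def len)
  have "P * Q = 1\<^sub>m ?n"
  proof (rule eq_matI)
    fix k j assume kj: "k < dim_row (1\<^sub>m ?n)" "j < dim_col (1\<^sub>m ?n)"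
    then have "(P * Q) $$ (k, j) = pconst (\<Sum>l<?n.
        representation (set bs) (ys ! l) (bs ! k) * representation (set ys) (bs ! j) (ys ! l))"
      by (simp add: P_def Q_def scalar_prod_def lessThan_atLeast0 pconst_sum pconst_mult)
    also have "\<dots> = pconst (representation (set bs) (bs ! j) (bs ! k))"
      by (simp add: representation_change_basis[OF bs ys, of "bs ! j"])
    also have "\<dots> = 1\<^sub>m ?n $$ (k, j)"
      using bs kj len
      by (auto simp: ordered_basis_def representation_basis nth_eq_iff_index_eq pconst_0 pconst_1)
    finally show "(P * Q) $$ (k, j) = 1\<^sub>m ?n $$ (k, j)" .
  qed (use carrier in auto)
  then have PQ: "det P * det Q = 1"
    using det_mult[OF carrier(1,2)] by simp
  have "?B * P = P * ?A"
  proof (rule eq_matI)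
    fix k j assume kj: "k < dim_row (P * ?A)" "j < dim_col (P * ?A)"
    then have kj: "k < ?n" "j < ?n" using carrier by auto
    let ?r = "\<lambda>v. representation (set bs) v (bs ! k)"
    have "(?B * P) $$ (k, j) = (\<Sum>l<?n. ((if k = l then pvar 0 else 0) +
        (\<Sum>i<?n. pvar (Suc i) * pconst (ad_entry bs (ys ! i) k l)))
        * pconst (representation (set bs) (ys ! j) (bs ! l)))"
      using kj by (simp add: P_def lie_char_mat_def scalar_prod_def lessThan_atLeast0 len)
    also have "\<dots> = pvar 0 * pconst (?r (ys ! j)) + (\<Sum>i<?n. pvar (Suc i) *
        pconst (\<Sum>l<?n. ad_entry bs (ys ! i) k l * representation (set bs) (ys ! j) (bs ! l)))"
      unfolding sum_pencil_mult[OF kj(1)] by (simp only: pconst_sum pconst_mult)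
    also have "\<dots> = pvar 0 * pconst (?r (ys ! j)) + (\<Sum>i<?n. pvar (Suc i) *
        pconst (?r (bracket (ys ! i) (ys ! j))))"
      using len by (simp add: representation_ad[OF bs, of _ "ys ! j"] ad_entry_def)
    also have "\<dots> = pvar 0 * pconst (?r (ys ! j)) + (\<Sum>i<?n. pvar (Suc i) *
        pconst (\<Sum>l<?n. ?r (ys ! l) * ad_entry ys (ys ! i) l j))"
      by (simp add: representation_change_basis[OF bs ys, of "bracket _ _"] ad_entry_def)
    also have "\<dots> = (\<Sum>l<?n. ((if j = l then pvar 0 else 0) +
        (\<Sum>i<?n. pvar (Suc i) * pconst (ad_entry ys (ys ! i) l j))) * pconst (?r (ys ! l)))"
      unfolding sum_pencil_mult[OF kj(2)]
      by (simp only: pconst_sum pconst_mult mult.commute[of "pconst (?r _)"])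
    also have "\<dots> = (P * ?A) $$ (k, j)"
      using kj by (simp add: P_def lie_char_mat_def scalar_prod_def lessThan_atLeast0 len
          mult.commute eq_commute[of j])
    finally show "(?B * P) $$ (k, j) = (P * ?A) $$ (k, j)" .
  qed (use carrier in auto)
  then have "det P * det ?A = det P * det ?B"
    unfolding det_mult[OF carrier(1,3), symmetric] mult.commute[of "det P" "det ?B"]
      det_mult[OF carrier(4,1), symmetric] by (rule arg_cong[OF sym])
  moreover have "det P \<noteq> 0" using PQ by auto
  ultimately show ?thesis using mult_cancel_left by blast
qed

lemma lie_char_poly_eq_prod:
  assumes tri: "triangularizing_basis UNIV bs" and ys: "ordered_basis UNIV ys"
  shows "lie_char_poly ys
    = (\<Prod>k<length bs. linear_form (length ys) (\<lambda>j. ad_entry bs (ys ! j) k k))"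
proof -
  let ?n = "length ys" and ?B = "lie_char_mat ys bs"
  have bs: "ordered_basis UNIV bs" using tri by (simp add: triangularizing_basis_def)
  have len: "length bs = length ys"
    using bs ys dim_span_eq_card_independent[of "set bs"] dim_span_eq_card_independent[of "set ys"]
    by (simp add: ordered_basis_def distinct_card)
  have B: "?B \<in> carrier_mat ?n ?n" by (simp add: lie_char_mat_def len)
  have "lie_char_poly ys = det (lie_char_mat ys ys)"
    by (simp add: lie_char_poly_def lie_char_mat_def)
  also have "\<dots> = det ?B" by (rule det_lie_char_mat_change_basis[OF bs ys len])
  also have "\<dots> = prod_list (diag_mat ?B)"
  proof (rule det_upper_triangular[OF _ B], rule upper_triangularI)
    fix i j assume "j < i" "i < dim_row ?B"
    then show "?B $$ (i, j) = 0"
      using tri by (simp add: lie_char_mat_def triangularizing_basis_def pconst_0)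
  qed
  also have "\<dots> = (\<Prod>k<?n. ?B $$ (k, k))"
    using B by (simp add: diag_mat_def prod.list_conv_set_nth lessThan_atLeast0)
  also have "\<dots> = (\<Prod>k<length bs. linear_form ?n (\<lambda>j. ad_entry bs (ys ! j) k k))"
    unfolding len by (intro prod.cong refl) (simp add: lie_char_mat_def linear_form_def len)
  finally show ?thesis .
qed

text \<open>
  In a triangularizing basis the determinant is a product of linear forms, one for each diagonal
  functional. The coefficients of a form are the values of the functional on the basis \<open>ys\<close>, so equal
  forms come from equal functionals.
\<close>

theorem spectral_index_eq_card:
  assumes tri: "triangularizing_basis UNIV bs" and ys: "ordered_basis UNIV ys"
  shows "spectral_index ys = card ((\<lambda>k y. ad_entry bs y k k) ` {..<length bs})"
proof -
  let ?w = "\<lambda>k y. ad_entry bs y k k"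
  let ?L = "\<lambda>f. linear_form (length ys) (\<lambda>j. f (ys ! j))"
  have "inj_on ?L (?w ` {..<length bs})"
  proof (rule inj_onI)
    fix f g assume f: "f \<in> ?w ` {..<length bs}" and g: "g \<in> ?w ` {..<length bs}"
      and eq: "?L f = ?L g"
    have lin: "h (x + y) = h x + h y" "h (a \<cdot> x) = a * h x" if "h \<in> ?w ` {..<length bs}" for h x y a
      using that ad_entry_add[OF tri lie_ideal_UNIV] ad_entry_scale[OF tri lie_ideal_UNIV] by auto
    have "?L f dvd ?L g" unfolding eq by (rule dvd_refl)
    then have on_ys: "f y = g y" if "y \<in> set ys" for y
      using that unfolding linear_form_dvd_linear_form_iff by (auto simp: in_set_conv_nth)
    show "f = g"
    proof
      fix x
      have "x \<in> span (set ys)" using ys by (simp add: ordered_basis_def)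
      then show "f x = g x"
      proof (induct rule: span_induct_alt)
        case base
        show ?case using lin(2)[OF f, of 0 0] lin(2)[OF g, of 0 0] by simp
      next
        case (step c x y)
        then show ?case by (simp add: lin[OF f] lin[OF g] on_ys)
      qed
    qed
  qed
  then have "card (?L ` ?w ` {..<length bs}) = card (?w ` {..<length bs})"
    by (rule card_image)
  then show ?thesis
    unfolding spectral_index_def lie_char_poly_eq_prod[OF tri ys]
      num_irreducible_factors_prod_linear_forms[OF finite_lessThan]
    by (simp add: image_image)
qed

end

section \<open>Functionals separating points\<close>

lemma (in vector_space) card_eq_dim_spanning_iff:
  assumes "finite S" "span S = V"
  shows "card S = dim V \<longleftrightarrow> independent S"
proof
  assume card: "card S = dim V"
  show "independent S"
  proof (rule ccontr)
    assume "\<not> independent S"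
    then obtain a where a: "a \<in> S" "a \<in> span (S - {a})" by (auto simp: dependent_def)
    then have "span (S - {a}) = span S"
      using span_redundant[OF a(2)] by (simp add: insert_absorb)
    then have "dim V \<le> card (S - {a})"
      using assms span_superset by (intro dim_le_card) auto
    moreover have "card (S - {a}) < card S" using a(1) assms(1) by (rule card_Diff1_less[rotated])
    ultimately show False using card by simp
  qed
qed (use assms in \<open>auto simp: dim_eq_card_independent\<close>)

context complex_lie_algebra
begin

abbreviation dual :: "'a set \<Rightarrow> ('a \<Rightarrow> complex) set"
  where "dual \<equiv> dual_space scale"

lemma subspace_dual: "functionals.subspace (dual V)"
  by (rule functionals.subspaceI) (auto simp: dual_space_def fscale_def algebra_simps)

lemma dual_diff:
  assumes f: "f \<in> dual V" and V: "subspace V" "x \<in> V" "y \<in> V"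
  shows "f (x - c \<cdot> y) = f x - c * f y"
proof -
  have "(- c) \<cdot> y \<in> V" by (rule subspace_scale[OF V(1,3)])
  then have "f (x + (- c) \<cdot> y) = f x + f ((- c) \<cdot> y)"
    using f V unfolding dual_space_def by blast
  also have "f ((- c) \<cdot> y) = (- c) * f y"
    using f V unfolding dual_space_def by blast
  finally show ?thesis by simp
qed

text \<open>
  When \<open>g\<close> is added to \<open>G\<close>, either \<open>g\<close> vanishes on the common kernel of \<open>G\<close>, so that this kernel does not
  shrink, or \<open>g\<close> is nonzero at some \<open>u\<close> in it. In the second case subtracting the multiple of \<open>g\<close> that
  cancels \<open>f\<close> at \<open>u\<close> makes \<open>f\<close> vanish on the common kernel of \<open>G\<close>.
\<close>

lemma in_span_of_common_kernel:
  assumes V: "subspace V" and "finite G" "G \<subseteq> dual V" "f \<in> dual V"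
    and "\<And>x. x \<in> V \<Longrightarrow> (\<forall>g\<in>G. g x = 0) \<Longrightarrow> f x = 0"
  shows "f \<in> functionals.span G"
  using assms(2-)
proof (induct G arbitrary: f)
  case empty
  then have "f = 0" by (auto simp: fun_eq_iff dual_space_def)
  then show ?case using functionals.span_zero by blast
next
  case (insert g G)
  show ?case
  proof (cases "\<exists>u\<in>V. (\<forall>h\<in>G. h u = 0) \<and> g u \<noteq> 0")
    case False
    then have "f \<in> functionals.span G" using insert by (intro insert.hyps) auto
    then show ?thesis using functionals.span_mono[of G "insert g G"] by auto
  next
    case True
    then obtain u where u: "u \<in> V" "\<And>h. h \<in> G \<Longrightarrow> h u = 0" "g u \<noteq> 0" by auto
    define c where "c = f u / g u"
    have "f - fscale c g \<in> functionals.span G"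
    proof (rule insert.hyps)
      show "f - fscale c g \<in> dual V"
        using insert by (intro functionals.subspace_diff functionals.subspace_scale subspace_dual) auto
    next
      fix x assume x: "x \<in> V" "\<forall>h\<in>G. h x = 0"
      let ?y = "x - (g x / g u) \<cdot> u"
      have "?y \<in> V" using x u V by (intro subspace_diff subspace_scale)
      have eval: "h ?y = h x - (g x / g u) * h u" if "h \<in> insert f (insert g G)" for h
        using that insert x u V by (intro dual_diff) auto
      have "g ?y = 0" using eval[of g] u by simp
      moreover have "h ?y = 0" if "h \<in> G" for h using eval[of h] x u(2)[OF that] that by simp
      ultimately have "\<forall>h\<in>insert g G. h ?y = 0" by simp
      with \<open>?y \<in> V\<close> have "f ?y = 0" by (rule insert.prems(3))
      then have "f x - (g x / g u) * f u = 0" using eval[of f] by simp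
      then show "(f - fscale c g) x = 0" by (simp add: fscale_def c_def)
    qed (use insert in auto)
    then show ?thesis unfolding functionals.span_breakdown_eq by blast
  qed
qed

lemma restrict0_linear_in_dual:
  assumes "subspace V" "\<And>x y. h (x + y) = h x + h y" "\<And>c x. h (c \<cdot> x) = c * h x"
  shows "restrict0 V h \<in> dual V"
  using assms by (auto simp: dual_space_def restrict0_def subspace_add subspace_scale)

lemma sum_fun_apply: "(\<Sum>i\<in>A. f i) x = (\<Sum>i\<in>A. f i x)"
  by (induct A rule: infinite_finite_induct) simp_all

text \<open>
  The coordinate functionals form a basis; they span because they have no common zero besides 0.
\<close>

lemma dim_dual:
  assumes fs: "ordered_basis V fs"
  shows "functionals.dim (dual V) = length fs"
proof -
  let ?B = "set fs"
  define coord where "coord b = restrict0 V (\<lambda>x. representation ?B x b)" for b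
  have B: "distinct fs" "independent ?B" "span ?B = V" using fs by (auto simp: ordered_basis_def)
  have V: "subspace V" using B by auto
  have BV: "b \<in> V" if "b \<in> ?B" for b using that B span_base by blast
  have delta: "coord b b' = (if b = b' then 1 else 0)" if "b \<in> ?B" "b' \<in> ?B" for b b'
    using that B BV by (auto simp: coord_def restrict0_def representation_basis)
  have inj: "inj_on coord ?B"
  proof (rule inj_onI)
    fix b b' assume "b \<in> ?B" "b' \<in> ?B" "coord b = coord b'"
    then have "coord b b' = coord b' b'" by simp
    then show "b = b'" using delta \<open>b \<in> ?B\<close> \<open>b' \<in> ?B\<close> by (auto split: if_splits)
  qed
  have dual: "coord b \<in> dual V" for b
    using B V by (auto simp: coord_def dual_space_def restrict0_def subspace_add subspace_scale
        representation_add representation_scale)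
  have ind: "functionals.independent (coord ` ?B)"
  proof (rule functionals.independent_if_scalars_zero)
    fix u \<psi> assume u: "(\<Sum>\<phi>\<in>coord ` ?B. fscale (u \<phi>) \<phi>) = 0" and "\<psi> \<in> coord ` ?B"
    then obtain b where b: "b \<in> ?B" "\<psi> = coord b" by auto
    have "0 = (\<Sum>\<phi>\<in>coord ` ?B. fscale (u \<phi>) \<phi>) b" unfolding u by simp
    also have "\<dots> = (\<Sum>c\<in>?B. u (coord c) * coord c b)"
      by (simp add: sum.reindex[OF inj] sum_fun_apply fscale_def)
    also have "\<dots> = (\<Sum>c\<in>?B. if c = b then u (coord c) else 0)"
      by (intro sum.cong refl) (simp add: delta b)
    also have "\<dots> = u (coord b)" using b by simp
    finally show "u \<psi> = 0" using b by simp
  qed simp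
  have "dual V \<subseteq> functionals.span (coord ` ?B)"
  proof
    fix f assume f: "f \<in> dual V"
    show "f \<in> functionals.span (coord ` ?B)"
    proof (rule in_span_of_common_kernel[OF V _ _ f])
      fix x assume x: "x \<in> V" "\<forall>g\<in>coord ` ?B. g x = 0"
      have "x = (\<Sum>b\<in>?B. representation ?B x b \<cdot> b)"
        by (rule sum_representation_eq[symmetric]) (use B x in auto)
      also have "\<dots> = 0"
        by (rule sum.neutral) (use x in \<open>auto simp: coord_def restrict0_def\<close>)
      finally have "x = 0" .
      moreover have "f (0 - 1 \<cdot> 0) = f 0 - 1 * f 0"
        using V f by (intro dual_diff) (auto simp: subspace_0)
      ultimately show "f x = 0" by simp
    qed (use dual in auto)
  qed
  then have "card (coord ` ?B) = functionals.dim (dual V)"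
    using dual ind by (intro functionals.basis_card_eq_dim) auto
  then show ?thesis using inj B by (simp add: card_image distinct_card)
qed

end

section \<open>Counting distinct elements of a multiset\<close>

lemma card_set_mset_minus:
  "card (set_mset A - {z}) \<le> size A"
  "card (set_mset A - {z}) = size A \<longleftrightarrow> z \<notin># A \<and> (\<forall>a\<in>#A. count A a = 1)"
proof -
  have size: "size A = (\<Sum>a\<in>set_mset A. count A a)" by (simp add: size_multiset_overloaded_eq)
  have card: "card (set_mset A) = (\<Sum>a\<in>set_mset A. 1)" by simp
  have le: "card (set_mset A) \<le> size A"
    unfolding size card by (rule sum_mono) (simp add: Suc_le_eq)
  have le': "card (set_mset A - {z}) \<le> card (set_mset A)" by (simp add: card_Diff1_le)
  show "card (set_mset A - {z}) \<le> size A" using le le' by simp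
  show "card (set_mset A - {z}) = size A \<longleftrightarrow> z \<notin># A \<and> (\<forall>a\<in>#A. count A a = 1)"
  proof
    assume eq: "card (set_mset A - {z}) = size A"
    then have "z \<notin># A" using le card_Diff1_less[of "set_mset A" z] by force
    moreover have "count A a = 1" if "a \<in># A" for a
    proof (rule ccontr)
      assume "count A a \<noteq> 1"
      then have "1 < count A a" using that count_greater_zero_iff[of A a] by linarith
      then have "card (set_mset A) < size A"
        unfolding size card using that by (intro sum_strict_mono_ex1) (auto simp: Suc_le_eq)
      then show False using eq le' by simp
    qed
    ultimately show "z \<notin># A \<and> (\<forall>a\<in>#A. count A a = 1)" by blast
  next
    assume "z \<notin># A \<and> (\<forall>a\<in>#A. count A a = 1)"
    then show "card (set_mset A - {z}) = size A" by (simp add: size)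
  qed
qed

section \<open>Spectral index and weights\<close>

locale solvable_lie_algebra_split = solvable_lie_algebra scale bracket ys
  for scale :: "complex \<Rightarrow> 'a::ab_group_add \<Rightarrow> 'a" (infixr "\<cdot>" 75) and bracket ys +
  fixes \<nn> \<vv> :: "'a set"
  assumes nilradical: "is_nilradical \<nn>" and complement: "is_complement \<nn> \<vv>"
    and nonzero: "(UNIV :: 'a set) \<noteq> {0}"
begin

abbreviation "weights \<equiv> set_mset (weight_mset \<nn> \<vv>)"

lemma adapted_bases:
  obtains es fs where "triangularizing_basis \<nn> es" "ordered_basis \<vv> fs"
    and "weight_mset \<nn> \<vv> = mset (map (\<lambda>i. restrict0 \<vv> (\<lambda>y. ad_entry es y i i)) [0..<length es])"
proof -
  define es where "es = (SOME es. triangularizing_basis \<nn> es)"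
  have "triangularizing_basis \<nn> es"
    unfolding es_def
    by (rule someI_ex[OF triangularizing_basis_exists]) (use nilradical in \<open>simp add: is_nilradical_def\<close>)
  moreover have "subspace \<vv>" using complement by (simp add: is_complement_def)
  then obtain B where B: "finite B" "independent B" "span B = \<vv>"
    by (rule basis_subspace_exists)
  moreover obtain fs where "set fs = B" "distinct fs"
    using finite_distinct_list[OF B(1)] by blast
  ultimately show ?thesis
    by (intro that[of es fs]) (auto simp: ordered_basis_def weight_mset_def es_def[symmetric] Let_def)
qed

lemma dim_ordered_basis: "ordered_basis V bs \<Longrightarrow> dim V = length bs"
  by (auto simp: ordered_basis_def dim_eq_card_independent distinct_card)

lemma size_weight_mset: "size (weight_mset \<nn> \<vv>) = dim \<nn>"
proof -
  obtain es fs where "triangularizing_basis \<nn> es"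
    and w: "weight_mset \<nn> \<vv> = mset (map (\<lambda>i. restrict0 \<vv> (\<lambda>y. ad_entry es y i i)) [0..<length es])"
    by (rule adapted_bases)
  then have "dim \<nn> = length es" by (simp add: triangularizing_basis_def dim_ordered_basis)
  then show ?thesis unfolding w by simp
qed

text \<open>
  On the complement the diagonal functionals of the whole algebra are the weights and a zero for each
  dimension of the complement. Zero occurs among them even when the complement is trivial.
\<close>

lemma weights_eq:
  obtains bs where "triangularizing_basis UNIV bs"
    and "insert 0 weights = restrict0 \<vv> ` (\<lambda>i y. ad_entry bs y i i) ` {..<length bs}"
proof -
  obtain es fs where es: "triangularizing_basis \<nn> es" and fs: "ordered_basis \<vv> fs"
    and w: "weight_mset \<nn> \<vv> = mset (map (\<lambda>i. restrict0 \<vv> (\<lambda>y. ad_entry es y i i)) [0..<length es])"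
    by (rule adapted_bases)
  note app = triangularizing_basis_append[OF nilradical es fs complement]
  let ?bs = "es @ fs" let ?w = "\<lambda>i. restrict0 \<vv> (\<lambda>y. ad_entry ?bs y i i)"
  have weights: "weights = ?w ` {..<length es}"
    unfolding w by (auto simp: app(2))
  have tail: "?w i = 0" if "length es \<le> i" "i < length ?bs" for i
    using app(3)[OF that] by (simp add: restrict0_def fun_eq_iff)
  have "0 \<in> ?w ` {..<length ?bs}"
  proof (cases "fs = []")
    case False
    then have "?w (length es) = 0" by (intro tail) auto
    then show ?thesis using False by (intro image_eqI[of _ _ "length es"]) auto
  next
    case True
    \<comment> \<open>The algebra is its own nilradical. Functionals restricted to the zero space vanish, and at least
        one weight exists because the algebra is nonzero.\<close>
    then have v: "\<vv> = {0}" using fs by (simp add: ordered_basis_def)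
    have "ordered_basis UNIV ?bs" using app(1) by (simp add: triangularizing_basis_def)
    then have pos: "0 < length ?bs" using nonzero by (auto simp: ordered_basis_def)
    have "ad_entry ?bs 0 0 0 = 0"
      using ad_entry_scale[OF app(1) lie_ideal_UNIV pos, of 0 0] by simp
    then have "?w 0 = 0" by (auto simp: v restrict0_def fun_eq_iff)
    then show ?thesis using pos by (intro image_eqI[of _ _ 0]) auto
  qed
  then have "insert 0 weights = ?w ` {..<length ?bs}"
    unfolding weights using tail by (auto simp: image_iff) (metis lessThan_iff not_le)
  then show ?thesis using app(1) by (intro that[of ?bs]) (simp_all add: image_image)
qed

text \<open>
  A diagonal functional vanishes on the nilradical, so restriction to the complement loses nothing.
  The summand 1 is the irreducible factor $z_0$.
\<close>

lemma spectral_index_eq: "spectral_index ys = card (weights - {0}) + 1"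
proof -
  obtain bs where tri: "triangularizing_basis UNIV bs"
    and w: "insert 0 weights = restrict0 \<vv> ` (\<lambda>i y. ad_entry bs y i i) ` {..<length bs}"
    by (rule weights_eq)
  let ?W = "(\<lambda>i y. ad_entry bs y i i) ` {..<length bs}"
  have "inj_on (restrict0 \<vv>) ?W"
  proof (rule inj_onI, rule ext)
    fix f g x assume f: "f \<in> ?W" and g: "g \<in> ?W" and eq: "restrict0 \<vv> f = restrict0 \<vv> g"
    obtain u v where x: "x = u + v" "u \<in> \<nn>" "v \<in> \<vv>"
      using complement UNIV_I[of x] unfolding is_complement_def by blast
    have h: "h x = h v" if "h \<in> ?W" for h
      using that x(2) unfolding x(1) nilradical_eq_diag_zero[OF tri nilradical]
      by (auto simp: ad_entry_add[OF tri lie_ideal_UNIV])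
    have "f v = g v" using fun_cong[OF eq, of v] x by (simp add: restrict0_def)
    then show "f x = g x" unfolding h[OF f] h[OF g] .
  qed
  then have "card (insert 0 weights) = card ?W" unfolding w by (rule card_image)
  moreover have "spectral_index ys = card ?W"
    by (rule spectral_index_eq_card[OF tri ys_basis])
  ultimately show ?thesis by (metis card.insert_remove Suc_eq_plus1 finite_set_mset)
qed

text \<open>
  An element of the complement at which all weights vanish has zero diagonal, so it lies in the
  nilradical and is zero. Functionals without common zeros span the dual.
\<close>

lemma span_weights: "functionals.span (weights - {0}) = dual \<vv>"
proof
  obtain bs where tri: "triangularizing_basis UNIV bs"
    and w: "insert 0 weights = restrict0 \<vv> ` (\<lambda>i y. ad_entry bs y i i) ` {..<length bs}"
    by (rule weights_eq)
  have v: "subspace \<vv>" using complement by (simp add: is_complement_def)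
  have "insert 0 weights \<subseteq> dual \<vv>"
    unfolding w using ad_entry_add[OF tri lie_ideal_UNIV] ad_entry_scale[OF tri lie_ideal_UNIV]
    by (auto intro!: restrict0_linear_in_dual[OF v])
  then have sub: "weights - {0} \<subseteq> dual \<vv>" by blast
  then show "functionals.span (weights - {0}) \<subseteq> dual \<vv>"
    by (rule functionals.span_minimal) (rule subspace_dual)
  show "dual \<vv> \<subseteq> functionals.span (weights - {0})"
  proof
    fix f assume f: "f \<in> dual \<vv>"
    show "f \<in> functionals.span (weights - {0})"
    proof (rule in_span_of_common_kernel[OF v _ sub f])
      fix x assume x: "x \<in> \<vv>" "\<forall>g\<in>weights - {0}. g x = 0"
      then have zero: "g x = 0" if "g \<in> insert 0 weights" for g using that by (cases "g = 0") auto
      have "ad_entry bs x i i = 0" if "i < length bs" for i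
        using zero[unfolded w, OF imageI, OF imageI, of i] that x(1) by (simp add: restrict0_def)
      then have "x \<in> \<nn>" unfolding nilradical_eq_diag_zero[OF tri nilradical] by simp
      then have "x = 0" using complement x(1) by (auto simp: is_complement_def)
      moreover have "f (0 - 1 \<cdot> 0) = f 0 - 1 * f 0"
        using v f by (intro dual_diff) (auto simp: subspace_0)
      ultimately show "f x = 0" by simp
    qed simp
  qed
qed

lemma dim_complement: "dim \<vv> = functionals.dim (dual \<vv>)"
proof -
  obtain es fs where "ordered_basis \<vv> fs" by (rule adapted_bases)
  then show ?thesis by (simp add: dim_dual dim_ordered_basis)
qed

end

theorem theorem3p6:
  fixes scale :: "complex \<Rightarrow> 'a::ab_group_add \<Rightarrow> 'a"
    and bracket :: "'a \<Rightarrow> 'a \<Rightarrow> 'a"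
    and ys :: "'a list"
    and \<nn> \<vv> :: "'a set"
    and \<Delta> :: "('a \<Rightarrow> complex) set"
    and m :: "('a \<Rightarrow> complex) \<Rightarrow> nat"
    and \<kappa> :: nat
  assumes "complex_lie_algebra scale bracket"
    and "(UNIV :: 'a set) \<noteq> {0}"
    and "complex_lie_algebra.ordered_basis scale UNIV ys"
    and "complex_lie_algebra.lie_solvable scale bracket"
    and "complex_lie_algebra.is_nilradical scale bracket \<nn>"
    and "complex_lie_algebra.is_complement scale \<nn> \<vv>"
  defines "\<Delta> \<equiv> set_mset (complex_lie_algebra.weight_mset scale bracket \<nn> \<vv>)"
    and "m \<equiv> count (complex_lie_algebra.weight_mset scale bracket \<nn> \<vv>)"
    and "\<kappa> \<equiv> complex_lie_algebra.spectral_index scale bracket ys"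
  shows "(vector_space.dim scale \<vv> + 1 \<le> \<kappa> \<and> \<kappa> \<le> vector_space.dim scale \<nn> + 1) \<and>
    (\<kappa> = vector_space.dim scale \<vv> + 1 \<longleftrightarrow>
      functionals.independent (\<Delta> - {0}) \<and>
      functionals.span (\<Delta> - {0}) = dual_space scale \<vv>) \<and>
    (\<kappa> = vector_space.dim scale \<nn> + 1 \<longleftrightarrow> 0 \<notin> \<Delta> \<and> (\<forall>\<alpha>\<in>\<Delta>. m \<alpha> = 1))"
proof -
  interpret L: complex_lie_algebra scale bracket by (rule assms(1))
  interpret L: solvable_lie_algebra_split scale bracket ys \<nn> \<vv>
    by unfold_locales (use assms in simp_all)
  have \<kappa>: "\<kappa> = card (\<Delta> - {0}) + 1"
    unfolding \<kappa>_def \<Delta>_def by (rule L.spectral_index_eq)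
  have span: "functionals.span (\<Delta> - {0}) = dual_space scale \<vv>"
    unfolding \<Delta>_def by (rule L.span_weights)
  have fin: "finite (\<Delta> - {0})" by (simp add: \<Delta>_def)
  have "L.dim \<vv> \<le> card (\<Delta> - {0})"
    unfolding L.dim_complement using span fin by (intro functionals.dim_le_card) simp_all
  moreover have "card (\<Delta> - {0}) = L.dim \<vv> \<longleftrightarrow> functionals.independent (\<Delta> - {0})"
    unfolding L.dim_complement by (rule functionals.card_eq_dim_spanning_iff[OF fin span])
  moreover have "card (\<Delta> - {0}) \<le> L.dim \<nn>"
    unfolding \<Delta>_def L.size_weight_mset[symmetric] by (rule card_set_mset_minus(1))
  moreover have "card (\<Delta> - {0}) = L.dim \<nn> \<longleftrightarrow> 0 \<notin> \<Delta> \<and> (\<forall>\<alpha>\<in>\<Delta>. m \<alpha> = 1)"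
    unfolding \<Delta>_def m_def L.size_weight_mset[symmetric] by (rule card_set_mset_minus(2))
  ultimately show ?thesis unfolding \<kappa> using span by simp
qed

end
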